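(* Assume that $\mathcal{W}\subset\mathbb{R}^d$ is a closed convex set and that the noise distribution is $P_Z=\mathcal{N}(0,\mathbf{I}_d)$. Consider the following randomly stopped iterative process, run on a collection of cost functions $\{\mathsf{f}_t\}=\{\mathsf{f}_1,\dots,\mathsf{f}_n\}$ from $\mathsf{F}$: pick $W_1\sim\mu_1\in\mathcal{P}(\mathcal{W})$, pick $T$ uniformly at random from $\{1,\dots,n\}$, iterate $$W_{t+1}=\Pi_{\mathcal{W}}\big(\Psi_{\mathsf{f}_t}(W_t)+\sigma_tZ_t\big),\qquad Z_t\sim\mathcal{N}(0,\mathbf{I}_d),\qquad t=1,\dots,T,$$ and return $W_{T+1}$. This process is $(\varepsilon,\delta)$-DP for $\varepsilon\ge0$ and $$\delta=\max_{i\in\{1,\dots,n\}}\left\{\frac1n\sum_{t=i}^n\theta_{e^\varepsilon}\Big(\frac{\psi}{\sigma_i}\Big)\prod_{j=i+1}^t\theta_{e^\varepsilon}\Big(\frac{\mathrm{dia}(\Psi_{\mathsf{f}_j}(\mathcal{W}))}{\sigma_j}\Big)\right\}\le\frac1n\,\theta_{e^\varepsilon}\Big(\frac{\psi}{\sigma}\Big)\left[1-\theta_{e^\varepsilon}\Big(\frac{D}{\sigma}\Big)\right]^{-1},$$ where $\psi=\sup_{\mathsf{f},\mathsf{g}\in\mathsf{F}}\sup_{w\in\mathcal{W}}\|\Psi_{\mathsf{f}}(w)-\Psi_{\mathsf{g}}(w)\|$, $\sigma=\min_{t\in\{1,\dots,n\}}\sigma_t$ and $D=\max_{t\in\{1,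\dots,n\}}\mathrm{dia}(\Psi_{\mathsf{f}_t}(\mathcal{W}))$.
   Context: $\mathsf{F}$ is the collection of all possible convex cost functions $\mathsf{f}:\mathcal{W}\to\mathbb{R}$; each $\mathsf{f}\in\mathsf{F}$ has an associated update map $\Psi_{\mathsf{f}}:\mathcal{W}\to\mathbb{R}^d$, and $\|\Psi_{\mathsf{f}}(w)\|$ is uniformly bounded over $w\in\mathcal{W}$ and $\mathsf{f}\in\mathsf{F}$. The collection $\{\mathsf{f}_1,\dots,\mathsf{f}_n\}$ is fixed before the algorithm starts. $\sigma_t>0$ is the noise magnitude at time $t$; the $Z_t$ are i.i.d. (and independent of $W_1$ and $T$). $\mathcal{P}(\mathcal{W})$ is the set of probability measures on $\mathcal{W}$, $\Pi_{\mathcal{W}}$ is the projection onto $\mathcal{W}$, and $\mathrm{dia}(S)=\sup_{x_1,x_2\in S}\|x_2-x_1\|$. Empty products equal $1$. For $\gamma\ge1$ and probability measures $\mu,\nu$ on the same space, $\mathsf{E}_\gamma(\mu\|\nu)=\sup_A[\mu(A)-\gamma\nu(A)]$, the supremum being over measurable sets $A$. For $\gamma\ge1$ and $r\ge0$, $\theta_\gamma(r)=\mathsf{E}_\gamma(\mathcal{N}(ru,\mathbf{I}_d)\|\mathcal{N}(0,\mathbf{I}_d))=\mathsf{Q}\left(\frac{\log\gamma}{r}-\frac r2\right)-\gamma\,\mathsf{Q}\left(\frac{\log\gamma}{r}+\frac r2\right)$, where $u\in\mathbb{R}^d$ is any unit vector and $\mathsf{Q}(a)=\frac1{\sqrt{2\pi}}\int_a^\infty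 e^{-s^2/2}\,ds$ (the formula in $\mathsf{Q}$ being for $r>0$). Definition of DP: two collections $\{\mathsf{f}_t\}$ and $\{\mathsf{f}'_t\}$ are neighboring at index $i$ if $\mathsf{f}_t=\mathsf{f}'_t$ for all $t\ne i$ and $\mathsf{f}_i\ne\mathsf{f}'_i$. A randomized online algorithm is $(\varepsilon,\delta)$-DP at index $i$ if $\sup\mathsf{E}_{e^\varepsilon}(\mu\|\mu')\le\delta$, where the supremum is over all pairs of collections neighboring at index $i$ and $\mu,\mu'$ are the distributions of the algorithm's output on $\{\mathsf{f}_t\}$ and $\{\mathsf{f}'_t\}$ respectively (here, of $W_{T+1}$). It is $(\varepsilon,\delta)$-DP if it is $(\varepsilon,\delta)$-DP at index $i$ for all $i\in\{1,\dots,n\}$. *)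

theory Defs
  imports "HOL-Probability.Probability"
begin

definition hockey_stick :: "real \<Rightarrow> 'b measure \<Rightarrow> 'b measure \<Rightarrow> real" where
  "hockey_stick \<gamma> \<mu> \<nu> = (SUP A\<in>sets \<mu>. measure \<mu> A - \<gamma> * measure \<nu> A)"

definition gaussian :: "'a::euclidean_space \<Rightarrow> 'a measure" where
  "gaussian m = density lborel (\<lambda>x. ennreal (\<Prod>b\<in>Basis. normal_density (m \<bullet> b) 1 (x \<bullet> b)))"

text \<open>\<open>theta u \<gamma> r\<close> is meant for a unit vector \<open>u\<close>; its value does not depend on which one.\<close>

definition theta :: "'a::euclidean_space \<Rightarrow> real \<Rightarrow> real \<Rightarrow> real" where
  "theta u \<gamma> r = hockey_stick \<gamma> (gaussian (r *\<^sub>R u)) (gaussian 0)"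

text \<open>Unlike \<open>indep_var\<close>, this allows \<open>X\<close> and \<open>Y\<close> to take values in different types.\<close>

definition indep_rvs ::
  "'w measure \<Rightarrow> 'b measure \<Rightarrow> ('w \<Rightarrow> 'b) \<Rightarrow> 'c measure \<Rightarrow> ('w \<Rightarrow> 'c) \<Rightarrow> bool"
where
  "indep_rvs M N X N' Y \<longleftrightarrow> X \<in> measurable M N \<and> Y \<in> measurable M N' \<and>
     prob_space.indep_set M {X -` A \<inter> space M |A. A \<in> sets N} {Y -` B \<inter> space M |B. B \<in> sets N'}"

text \<open>Time is counted from 1 in the process, but the recursion counts steps: \<open>iterate W \<Psi> \<sigma> f w z t\<close> is \<open>W\<close> at time \<open>t + 1\<close>, so that
  the value at \<open>t = 0\<close> is the initial point and the value at \<open>t = T\<close> is the returned point.\<close>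

primrec iterate ::
  "'a::euclidean_space set \<Rightarrow> ('c \<Rightarrow> 'a \<Rightarrow> 'a) \<Rightarrow> (nat \<Rightarrow> real) \<Rightarrow> (nat \<Rightarrow> 'c) \<Rightarrow> 'a \<Rightarrow> (nat \<Rightarrow> 'a) \<Rightarrow> nat \<Rightarrow> 'a"
where
  "iterate W \<Psi> \<sigma> f w z 0 = w"
| "iterate W \<Psi> \<sigma> f w z (Suc t) =
     closest_point W (\<Psi> (f (Suc t)) (iterate W \<Psi> \<sigma> f w z t) + \<sigma> (Suc t) *\<^sub>R z (Suc t))"

definition stopped_law ::
  "'w measure \<Rightarrow> 'a::euclidean_space set \<Rightarrow> ('c \<Rightarrow> 'a \<Rightarrow> 'a) \<Rightarrow> (nat \<Rightarrow> real) \<Rightarrow>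
   ('w \<Rightarrow> 'a) \<Rightarrow> ('w \<Rightarrow> nat) \<Rightarrow> (nat \<Rightarrow> 'w \<Rightarrow> 'a) \<Rightarrow> (nat \<Rightarrow> 'c) \<Rightarrow> 'a measure"
where
  "stopped_law M W \<Psi> \<sigma> W1 T Z f =
     distr M (restrict_space borel W) (\<lambda>\<omega>. iterate W \<Psi> \<sigma> f (W1 \<omega>) (\<lambda>t. Z t \<omega>) (T \<omega>))"

definition neighboring :: "nat \<Rightarrow> nat \<Rightarrow> (nat \<Rightarrow> 'c) \<Rightarrow> (nat \<Rightarrow> 'c) \<Rightarrow> bool" where
  "neighboring n i f f' \<longleftrightarrow> (\<forall>t\<in>{1..n} - {i}. f t = f' t) \<and> f i \<noteq> f' i"

text \<open>An algorithm is represented by the map \<open>A\<close> from a collection to the law of its output. The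
  set \<open>P\<close> consists of the admissible pairs of collections; differential privacy in the usual
  sense is the case that \<open>P\<close> contains all pairs. The supremum is taken in the extended
  reals because there may be no neighboring pair at all.\<close>

definition dp_at_index ::
  "nat \<Rightarrow> ((nat \<Rightarrow> 'c) \<times> (nat \<Rightarrow> 'c)) set \<Rightarrow> ((nat \<Rightarrow> 'c) \<Rightarrow> 'b measure) \<Rightarrow> real \<Rightarrow> real \<Rightarrow> nat \<Rightarrow> bool"
where
  "dp_at_index n P A \<epsilon> \<delta> i \<longleftrightarrow>
     (SUP (f, f')\<in>{(f, f')\<in>P. neighboring n i f f'}.
        ereal (hockey_stick (exp \<epsilon>) (A f) (A f'))) \<le> ereal \<delta>"

definition dp ::
  "nat \<Rightarrow> ((nat \<Rightarrow> 'c) \<times> (nat \<Rightarrow> 'c)) set \<Rightarrow> ((nat \<Rightarrow> 'c) \<Rightarrow> 'b measure) \<Rightarrow> real \<Rightarrow> real \<Rightarrow> bool"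
where
  "dp n P A \<epsilon> \<delta> \<longleftrightarrow> (\<forall>i\<in>{1..n}. dp_at_index n P A \<epsilon> \<delta> i)"

definition sensitivity :: "'a::euclidean_space set \<Rightarrow> 'c set \<Rightarrow> ('c \<Rightarrow> 'a \<Rightarrow> 'a) \<Rightarrow> real" where
  "sensitivity W F \<Psi> = (SUP f\<in>F. SUP g\<in>F. SUP w\<in>W. norm (\<Psi> f w - \<Psi> g w))"

definition stopped_delta ::
  "'a::euclidean_space \<Rightarrow> nat \<Rightarrow> 'a set \<Rightarrow> 'c set \<Rightarrow> ('c \<Rightarrow> 'a \<Rightarrow> 'a) \<Rightarrow> (nat \<Rightarrow> real) \<Rightarrow> real \<Rightarrow> (nat \<Rightarrow> 'c) \<Rightarrow> real"
where
  "stopped_delta u n W F \<Psi> \<sigma> \<epsilon> f =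
     (MAX i\<in>{1..n}. 1 / real n * (\<Sum>t=i..n. theta u (exp \<epsilon>) (sensitivity W F \<Psi> / \<sigma> i) *
        (\<Prod>j=i+1..t. theta u (exp \<epsilon>) (diameter (\<Psi> (f j) ` W) / \<sigma> j))))"

end

theory Submission
  imports Defs
begin

text \<open>One noisy step from a point \<open>w\<close> is a push-forward of a Gaussian centred at \<open>\<Psi> w / \<sigma>\<close>, so by
  data processing the divergence of the steps from two points is at most that of two Gaussians. By
  Neyman--Pearson the latter is attained on a half-space, hence it is a difference of two normal
  tails; it depends only on the distance of the centres and increases with it, because for a fixed
  half-space only the first tail depends on the distance.
  A Markov kernel contracts the hockey-stick divergence by the factor \<open>\<eta>\<close>, the largest divergence of
  its values at two points: if \<open>l\<close> and \<open>s\<close> are the infimum and supremum of a test function \<open>\<phi>\<close>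
  and \<open>e \<le> 1\<close> is the divergence of \<open>\<mu>\<close> and \<open>\<nu>\<close>, then
  \<open>\<integral>\<phi> d\<mu> - \<gamma> \<integral>\<phi> d\<nu> \<le> (s - l) e + (1 - \<gamma>) l \<le> (s - \<gamma> l) e \<le> \<eta> e\<close>.
  Two runs on collections that differ at index \<open>i\<close> have equal laws before step \<open>i\<close>, separate by at
  most \<open>\<theta>(\<psi> / \<sigma> i)\<close> in step \<open>i\<close>, and contract in all later steps. The stopped law is the average of
  the laws at the fixed times, and the divergence is convex.\<close>

section \<open>Gaussian measures\<close>

text \<open>The product form of the definition suits coordinatewise integration. This form shows
  that only the distance to the centre matters, which serves translation and the comparison of two
  densities.\<close>

lemma gaussian_density_eq:
  fixes m x :: "'a::euclidean_space"
  shows "(\<Prod>b\<in>Basis. normal_density (m \<bullet> b) 1 (x \<bullet> b)) =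
    (1 / sqrt (2 * pi)) ^ DIM('a) * exp (- (norm (x - m))\<^sup>2 / 2)"
proof -
  have "(\<Prod>b\<in>Basis. normal_density (m \<bullet> b) 1 (x \<bullet> b)) =
      (\<Prod>b\<in>(Basis::'a set). 1 / sqrt (2 * pi) * exp (- (((x - m) \<bullet> b)\<^sup>2 / 2)))"
    by (simp add: normal_density_def inner_diff_left)
  also have "\<dots> = (1 / sqrt (2 * pi)) ^ DIM('a) * exp (\<Sum>b\<in>(Basis::'a set). - (((x - m) \<bullet> b)\<^sup>2 / 2))"
    by (simp only: prod.distrib prod_constant exp_sum finite_Basis)
  also have "(\<Sum>b\<in>(Basis::'a set). - (((x - m) \<bullet> b)\<^sup>2 / 2)) = - (norm (x - m))\<^sup>2 / 2"
    by (simp add: sum_negf sum_divide_distrib[symmetric] norm_eq_sqrt_inner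
        euclidean_inner[of "x - m" "x - m"] power2_eq_square sum_nonneg)
  finally show ?thesis .
qed

lemma sets_gaussian [simp, measurable_cong]: "sets (gaussian m) = sets borel"
  and space_gaussian [simp]: "space (gaussian m) = UNIV"
  by (auto simp: gaussian_def)

text \<open>Density and indicator of a box both factor over the coordinates, so Tonelli splits the
  integral. Total mass, marginals and independence all follow by choosing the sides
  \<open>A b\<close>.\<close>

lemma emeasure_gaussian_box:
  fixes m :: "'a::euclidean_space"
  assumes [measurable]: "\<And>b. b \<in> Basis \<Longrightarrow> A b \<in> sets borel"
  shows "emeasure (gaussian m) {x. \<forall>b\<in>Basis. x \<bullet> b \<in> A b} =
    (\<Prod>b\<in>Basis. emeasure (density lborel (normal_density (m \<bullet> b) 1)) (A b))"
proof -
  have [measurable]: "{x::'a. \<forall>b\<in>Basis. x \<bullet> b \<in> A b} \<in> sets borel"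
    by measurable
  have "emeasure (gaussian m) {x. \<forall>b\<in>Basis. x \<bullet> b \<in> A b} =
      (\<integral>\<^sup>+x. (\<Prod>b\<in>Basis. ennreal (normal_density (m \<bullet> b) 1 (x \<bullet> b)) * indicator (A b) (x \<bullet> b)) \<partial>lborel)"
    unfolding gaussian_def
  proof (subst emeasure_density; (measurable)?; intro nn_integral_cong)
    fix x :: 'a
    have "indicator {x. \<forall>b\<in>Basis. x \<bullet> b \<in> A b} x = (\<Prod>b\<in>Basis. indicator (A b) (x \<bullet> b) :: ennreal)"
      by (auto simp: indicator_def prod_zero_iff intro!: prod.neutral[symmetric])
    then show "ennreal (\<Prod>b\<in>Basis. normal_density (m \<bullet> b) 1 (x \<bullet> b)) * indicator {x. \<forall>b\<in>Basis. x \<bullet> b \<in> A b} x =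
        (\<Prod>b\<in>Basis. ennreal (normal_density (m \<bullet> b) 1 (x \<bullet> b)) * indicator (A b) (x \<bullet> b))"
      by (simp add: prod.distrib prod_ennreal)
  qed
  also have "\<dots> = (\<Prod>b\<in>Basis. (\<integral>\<^sup>+x. ennreal (normal_density (m \<bullet> b) 1 x) * indicator (A b) x \<partial>lborel))"
    by (rule nn_integral_lborel_prod) auto
  also have "\<dots> = (\<Prod>b\<in>Basis. emeasure (density lborel (normal_density (m \<bullet> b) 1)) (A b))"
    by (intro prod.cong refl, subst emeasure_density) auto
  finally show ?thesis .
qed

lemma prob_space_gaussian: "prob_space (gaussian m)"
proof
  show "emeasure (gaussian m) (space (gaussian m)) = 1"
    using emeasure_gaussian_box[of "\<lambda>_. UNIV" m]
      prob_space.emeasure_space_1[OF prob_space_normal_density[of 1]]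
    by simp
qed

lemma distr_gaussian_component:
  fixes m b :: "'a::euclidean_space"
  assumes b: "b \<in> Basis"
  shows "distr (gaussian m) borel (\<lambda>x. x \<bullet> b) = density lborel (normal_density (m \<bullet> b) 1)"
proof (rule measure_eqI)
  fix A :: "real set" assume "A \<in> sets (distr (gaussian m) borel (\<lambda>x. x \<bullet> b))"
  then have [measurable]: "A \<in> sets borel" by simp
  let ?A = "\<lambda>c. if c = b then A else UNIV"
  have "emeasure (distr (gaussian m) borel (\<lambda>x. x \<bullet> b)) A = emeasure (gaussian m) {x. x \<bullet> b \<in> A}"
    by (subst emeasure_distr) (auto simp: vimage_def)
  also have "{x. x \<bullet> b \<in> A} = {x. \<forall>c\<in>Basis. x \<bullet> c \<in> ?A c}"
    using b by auto
  also have "emeasure (gaussian m) \<dots> =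
      (\<Prod>c\<in>Basis. emeasure (density lborel (normal_density (m \<bullet> c) 1)) (?A c))"
    by (rule emeasure_gaussian_box) auto
  also have "\<dots> = (\<Prod>c\<in>Basis. if c = b then emeasure (density lborel (normal_density (m \<bullet> b) 1)) A else 1)"
    using prob_space.emeasure_space_1[OF prob_space_normal_density[of 1]]
    by (intro prod.cong) auto
  also have "\<dots> = emeasure (density lborel (normal_density (m \<bullet> b) 1)) A"
    using b by simp
  finally show "emeasure (distr (gaussian m) borel (\<lambda>x. x \<bullet> b)) A =
    emeasure (density lborel (normal_density (m \<bullet> b) 1)) A" .
qed simp

text \<open>Boxes determine a product measure, and on them the joint law of the coordinates is the
  product of the marginals.\<close>

lemma indep_vars_gaussian:
  fixes m :: "'a::euclidean_space"
  shows "prob_space.indep_vars (gaussian m) (\<lambda>_. borel) (\<lambda>b x. x \<bullet> b) Basis"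
proof -
  interpret prob_space "gaussian m" by (rule prob_space_gaussian)
  let ?N = "\<lambda>b. density lborel (normal_density (m \<bullet> b) 1)"
  have "distr (gaussian m) (\<Pi>\<^sub>M b\<in>Basis. borel) (\<lambda>x. \<lambda>b\<in>Basis. x \<bullet> b) = (\<Pi>\<^sub>M b\<in>Basis. ?N b)"
  proof -
    interpret N: product_prob_space ?N "Basis :: 'a set"
      by (simp add: product_prob_space_def product_prob_space_axioms_def product_sigma_finite_def
          prob_space_normal_density prob_space_imp_sigma_finite)
    show ?thesis
    proof (rule N.PiM_eqI)
      fix A :: "'a \<Rightarrow> real set" assume A: "\<And>b. b \<in> Basis \<Longrightarrow> A b \<in> sets (?N b)"
      then have [measurable]: "\<And>b. b \<in> Basis \<Longrightarrow> A b \<in> sets borel" by simp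
      have "emeasure (distr (gaussian m) (\<Pi>\<^sub>M b\<in>Basis. borel) (\<lambda>x. \<lambda>b\<in>Basis. x \<bullet> b)) (Pi\<^sub>E Basis A) =
          emeasure (gaussian m) {x. \<forall>b\<in>Basis. x \<bullet> b \<in> A b}"
        by (subst emeasure_distr)
          (auto simp: vimage_def PiE_iff intro!: sets_PiM_I_finite measurable_restrict arg_cong2[where f=emeasure])
      then show "emeasure (distr (gaussian m) (\<Pi>\<^sub>M b\<in>Basis. borel) (\<lambda>x. \<lambda>b\<in>Basis. x \<bullet> b)) (Pi\<^sub>E Basis A) =
          (\<Prod>b\<in>Basis. emeasure (?N b) (A b))"
        by (simp add: emeasure_gaussian_box)
    qed (auto intro!: sets_PiM_cong)
  qed
  also have "\<dots> = (\<Pi>\<^sub>M b\<in>Basis. distr (gaussian m) borel (\<lambda>x. x \<bullet> b))"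
    by (intro PiM_cong) (auto simp: distr_gaussian_component)
  finally show ?thesis
    by (subst indep_vars_iff_distr_eq_PiM') auto
qed

text \<open>\<open>v \<bullet> x\<close> is a sum of independent normals whose variances
  \<open>(v \<bullet> b)\<^sup>2\<close> add up to 1.\<close>

lemma distributed_gaussian_inner:
  fixes m v :: "'a::euclidean_space"
  assumes v: "norm v = 1"
  shows "distributed (gaussian m) lborel (\<lambda>x. v \<bullet> x) (normal_density (v \<bullet> m) 1)"
proof -
  interpret prob_space "gaussian m" by (rule prob_space_gaussian)
  \<comment> \<open>Coordinates with coefficient 0 would give degenerate normals, whereas
    \<open>sum_indep_normal\<close> asks for positive deviations and a nonempty index set.\<close>
  let ?I = "{b\<in>Basis. v \<bullet> b \<noteq> 0}"
  have ne: "?I \<noteq> {}"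
  proof
    assume "?I = {}"
    then have "v = 0" by (subst euclidean_all_zero_iff[symmetric]) blast
    with v show False by simp
  qed
  have sum_I: "(\<Sum>b\<in>?I. v \<bullet> b * (x \<bullet> b)) = v \<bullet> x" for x
    unfolding euclidean_inner[of v x] by (intro sum.mono_neutral_left) auto
  have "indep_vars (\<lambda>_. borel) (\<lambda>b x. x \<bullet> b) ?I"
    by (rule indep_vars_subset[OF indep_vars_gaussian]) auto
  from indep_vars_compose2[OF this, of "\<lambda>b y. v \<bullet> b * y" "\<lambda>_. borel"]
  have indep: "indep_vars (\<lambda>_. borel) (\<lambda>b x. v \<bullet> b * (x \<bullet> b)) ?I" by simp
  have "distributed (gaussian m) lborel (\<lambda>x. \<Sum>b\<in>?I. v \<bullet> b * (x \<bullet> b))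
      (normal_density (\<Sum>b\<in>?I. v \<bullet> b * (m \<bullet> b)) (sqrt (\<Sum>b\<in>?I. \<bar>v \<bullet> b\<bar>\<^sup>2)))"
  proof (rule sum_indep_normal[OF _ ne indep])
    fix b assume b: "b \<in> ?I"
    then have "distributed (gaussian m) lborel (\<lambda>x. x \<bullet> b) (normal_density (m \<bullet> b) 1)"
      using distr_gaussian_component[of b m] by (simp add: distributed_def cong: distr_cong)
    from normal_density_affine[OF this, of "v \<bullet> b" 0] b
    show "distributed (gaussian m) lborel (\<lambda>x. v \<bullet> b * (x \<bullet> b)) (normal_density (v \<bullet> b * (m \<bullet> b)) \<bar>v \<bullet> b\<bar>)"
      by simp
  qed auto
  moreover have "(\<Sum>b\<in>?I. \<bar>v \<bullet> b\<bar>\<^sup>2) = 1"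
    using sum_I[of v] v by (simp add: power2_eq_square norm_eq_1)
  ultimately show ?thesis
    by (simp add: sum_I)
qed

text \<open>Lebesgue measure is translation invariant and the density depends on
  \<open>x - m\<close> only.\<close>

lemma distr_gaussian_translate:
  fixes m a :: "'a::euclidean_space"
  shows "distr (gaussian m) borel (\<lambda>x. a + x) = gaussian (a + m)"
proof -
  have "gaussian (a + m) =
      density (distr lborel borel ((+) a)) (\<lambda>x. ennreal (\<Prod>b\<in>Basis. normal_density ((a + m) \<bullet> b) 1 (x \<bullet> b)))"
    by (simp add: gaussian_def lborel_distr_plus)
  also have "\<dots> = distr (density lborel (\<lambda>x. ennreal (\<Prod>b\<in>Basis. normal_density ((a + m) \<bullet> b) 1 ((a + x) \<bullet> b)))) borel ((+) a)"
    by (rule density_distr) auto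
  finally show ?thesis
    by (simp add: gaussian_density_eq gaussian_def)
qed

text \<open>This is the Gaussian tail function commonly written Q.\<close>

definition normal_tail :: "real \<Rightarrow> real" where
  "normal_tail c = measure (density lborel std_normal_density) {c<..}"

text \<open>After subtracting \<open>v \<bullet> m\<close>, the projection on the unit vector
  \<open>v\<close> is standard normal.\<close>

lemma measure_gaussian_halfspace:
  fixes m v :: "'a::euclidean_space"
  assumes v: "norm v = 1"
  shows "measure (gaussian m) {x. c < v \<bullet> x} = normal_tail (c - v \<bullet> m)"
proof -
  have e: "distr (gaussian m) borel (\<lambda>x. - (v \<bullet> m) + v \<bullet> x) = density lborel std_normal_density"
    using prob_space.normal_density_affine[OF prob_space_gaussian distributed_gaussian_inner[OF v, of m], of 1 "- (v \<bullet> m)"]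
    by (simp add: distributed_def cong: distr_cong)
  show ?thesis unfolding normal_tail_def e[symmetric]
    by (subst measure_distr) (auto intro!: arg_cong2[where f=measure])
qed

section \<open>Hockey-stick divergence of Gaussians\<close>

lemma hockey_stick_bdd:
  assumes "prob_space \<mu>" "0 \<le> \<gamma>"
  shows "bdd_above ((\<lambda>A. measure \<mu> A - \<gamma> * measure \<nu> A) ` sets \<mu>)"
proof (intro bdd_aboveI2)
  fix A
  have "measure \<mu> A \<le> 1" using assms(1) by (rule prob_space.prob_le_1)
  moreover have "0 \<le> \<gamma> * measure \<nu> A" using assms(2) by simp
  ultimately show "measure \<mu> A - \<gamma> * measure \<nu> A \<le> 1" by linarith
qed

lemma hockey_stick_upper:
  assumes "prob_space \<mu>" "0 \<le> \<gamma>" "A \<in> sets \<mu>"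
  shows "measure \<mu> A - \<gamma> * measure \<nu> A \<le> hockey_stick \<gamma> \<mu> \<nu>"
  unfolding hockey_stick_def by (rule cSUP_upper[OF assms(3) hockey_stick_bdd[OF assms(1,2)]])

lemma hockey_stick_least:
  assumes "\<And>A. A \<in> sets \<mu> \<Longrightarrow> measure \<mu> A - \<gamma> * measure \<nu> A \<le> c"
  shows "hockey_stick \<gamma> \<mu> \<nu> \<le> c"
  unfolding hockey_stick_def by (rule cSUP_least) (use assms sets.empty_sets in auto)

lemma hockey_stick_nonneg:
  assumes "prob_space \<mu>" "0 \<le> \<gamma>"
  shows "0 \<le> hockey_stick \<gamma> \<mu> \<nu>"
  using hockey_stick_upper[OF assms, of "{}" \<nu>] by simp

lemma hockey_stick_le_1:
  assumes "prob_space \<mu>" "0 \<le> \<gamma>"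
  shows "hockey_stick \<gamma> \<mu> \<nu> \<le> 1"
proof (rule hockey_stick_least)
  fix A
  have "measure \<mu> A \<le> 1" using assms(1) by (rule prob_space.prob_le_1)
  moreover have "0 \<le> \<gamma> * measure \<nu> A" using assms(2) by simp
  ultimately show "measure \<mu> A - \<gamma> * measure \<nu> A \<le> 1" by linarith
qed

lemma hockey_stick_self_le:
  assumes "1 \<le> \<gamma>"
  shows "hockey_stick \<gamma> \<mu> \<mu> \<le> 0"
proof (rule hockey_stick_least)
  fix A
  show "measure \<mu> A - \<gamma> * measure \<mu> A \<le> 0"
    using mult_right_mono[OF assms, of "measure \<mu> A"] by simp
qed

text \<open>Neyman-Pearson: \<open>H\<close> is where \<open>p - \<gamma> q\<close> is positive, so
  no other set gives a larger integral of this function.\<close>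

lemma hockey_stick_density_le:
  fixes p q :: "'b \<Rightarrow> real" and \<gamma> :: real
  assumes [measurable]: "p \<in> borel_measurable N" "q \<in> borel_measurable N"
    and nonneg: "\<And>x. 0 \<le> p x" "\<And>x. 0 \<le> q x"
    and prob: "prob_space (density N p)" "prob_space (density N q)"
  defines "H \<equiv> {x\<in>space N. \<gamma> * q x < p x}"
  shows "hockey_stick \<gamma> (density N p) (density N q) \<le>
    measure (density N p) H - \<gamma> * measure (density N q) H"
proof (rule hockey_stick_least)
  have H[measurable]: "H \<in> sets N" unfolding H_def by measurable
  \<comment> \<open>A nonnegative density of a finite measure is integrable.\<close>
  have int: "integrable N p" "integrable N q"
    using prob nonneg
    by (auto simp: integrable_density[symmetric, of _ N, where f="\<lambda>_. 1::real", simplified]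
        prob_space_def finite_measure.integrable_const)
  have meas: "measure (density N r) A = (\<integral>x. r x * indicator A x \<partial>N)"
    if [measurable]: "A \<in> sets N" "r \<in> borel_measurable N" and "\<And>x. 0 \<le> r x" for A and r :: "'b \<Rightarrow> real"
  proof -
    have "measure (density N r) A = (\<integral>x. indicator A x \<partial>density N r)"
      using that by (simp add: Int_absorb1[OF sets.sets_into_space] Int_absorb2[OF sets.sets_into_space])
    also have "\<dots> = (\<integral>x. r x * indicator A x \<partial>N)"
      using that by (subst integral_density) auto
    finally show ?thesis .
  qed
  have diff: "measure (density N p) A - \<gamma> * measure (density N q) A = (\<integral>x. (p x - \<gamma> * q x) * indicator A x \<partial>N)"
    if [measurable]: "A \<in> sets N" for A
    using int by (simp add: meas nonneg left_diff_distrib mult.assoc integrable_real_mult_indicator)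
  fix A assume "A \<in> sets (density N p)"
  then have A[measurable]: "A \<in> sets N" by simp
  have "(\<integral>x. (p x - \<gamma> * q x) * indicator A x \<partial>N) \<le> (\<integral>x. (p x - \<gamma> * q x) * indicator H x \<partial>N)"
    using int by (intro integral_mono integrable_real_mult_indicator)
      (auto simp: H_def indicator_def)
  then show "measure (density N p) A - \<gamma> * measure (density N q) A \<le>
      measure (density N p) H - \<gamma> * measure (density N q) H"
    by (simp add: diff)
qed

section \<open>Normal tails and the divergence of two Gaussians\<close>

lemma normal_tail_antimono: "c \<le> d \<Longrightarrow> normal_tail d \<le> normal_tail c"
  unfolding normal_tail_def
  by (rule finite_measure.finite_measure_mono[OF prob_space.finite_measure[OF prob_space_normal_density]]) auto

lemma normal_tail_nonneg: "0 \<le> normal_tail c"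
  by (simp add: normal_tail_def)

text \<open>The density is positive everywhere, so the complementary half-line has positive mass.
  The strict inequality later keeps the denominator of the geometric series positive.\<close>

lemma normal_tail_less_1: "normal_tail c < 1"
proof -
  let ?N = "density lborel std_normal_density"
  interpret prob_space ?N by (rule prob_space_normal_density) simp
  have "emeasure ?N {..c} \<noteq> 0"
  proof
    assume "emeasure ?N {..c} = 0"
    then have "{..c} \<in> null_sets ?N" by auto
    then have "AE x in lborel. x \<in> {..c} \<longrightarrow> std_normal_density x = 0"
      by (subst (asm) null_sets_density_iff) auto
    then have "AE x in lborel. x \<notin> {..c}"
      by eventually_elim (use normal_density_pos[of 1 0] in \<open>auto simp: less_le\<close>)
    then have "emeasure lborel {..c} = 0"
      by (simp add: AE_iff_null null_sets_def atMost_def)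
    \<comment> \<open>An interval of length 1 shows that the half-line is not a Lebesgue null
      set.\<close>
    moreover have "emeasure lborel {c-1..c} \<le> emeasure lborel {..c}"
      by (intro emeasure_mono) auto
    ultimately show False by simp
  qed
  then have "0 < prob {..c}"
    by (simp add: emeasure_eq_measure zero_less_measure_iff)
  moreover have "prob (space ?N - {..c}) = 1 - prob {..c}"
    by (rule prob_compl) simp
  moreover have "space ?N - {..c} = {c<..}" by auto
  ultimately show ?thesis unfolding normal_tail_def by simp
qed

text \<open>The logarithm of the likelihood ratio is affine in \<open>x\<close> with gradient
  \<open>a - b\<close>, so the optimal set is a half-space orthogonal to \<open>a - b\<close>, and
  its two masses are normal tails.\<close>

lemma hockey_stick_gaussian_le:
  fixes a b :: "'a::euclidean_space"
  assumes "a \<noteq> b" "0 < \<gamma>"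
  obtains c where "hockey_stick \<gamma> (gaussian a) (gaussian b) \<le> normal_tail (c - norm (a - b)) - \<gamma> * normal_tail c"
proof -
  define r where "r = norm (a - b)"
  define v where "v = (a - b) /\<^sub>R r"
  \<comment> \<open>Found by taking logarithms in \<open>\<gamma> * ?p b x < ?p a x\<close> and
    solving for \<open>v \<bullet> x\<close>; the normalising constants and
    \<open>(norm x)\<^sup>2\<close> cancel.\<close>
  define c where "c = (ln \<gamma> + ((norm a)\<^sup>2 - (norm b)\<^sup>2) / 2) / r"
  have r: "r > 0" using assms by (simp add: r_def)
  have v: "norm v = 1" using r by (simp add: v_def r_def)
  let ?p = "\<lambda>m x. \<Prod>k\<in>Basis. normal_density (m \<bullet> k) 1 (x \<bullet> k)"
  have "\<gamma> * ?p b x < ?p a x \<longleftrightarrow> c < v \<bullet> x" for x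
  proof -
    have "\<gamma> * ?p b x < ?p a x \<longleftrightarrow>
        (1 / sqrt (2 * pi)) ^ DIM('a) * (\<gamma> * exp (- (norm (x - b))\<^sup>2 / 2)) <
        (1 / sqrt (2 * pi)) ^ DIM('a) * exp (- (norm (x - a))\<^sup>2 / 2)"
      unfolding gaussian_density_eq by (simp only: mult.left_commute)
    also have "\<dots> \<longleftrightarrow> \<gamma> * exp (- (norm (x - b))\<^sup>2 / 2) < exp (- (norm (x - a))\<^sup>2 / 2)"
      by (rule mult_less_cancel_left_pos) simp
    also have "\<gamma> * exp (- (norm (x - b))\<^sup>2 / 2) = exp (ln \<gamma> - (norm (x - b))\<^sup>2 / 2)"
      using assms(2) by (simp only: diff_conv_add_uminus exp_add exp_ln minus_divide_left)
    also have "exp (ln \<gamma> - (norm (x - b))\<^sup>2 / 2) < exp (- (norm (x - a))\<^sup>2 / 2) \<longleftrightarrow>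
        ln \<gamma> + ((norm a)\<^sup>2 - (norm b)\<^sup>2) / 2 < (a - b) \<bullet> x"
      by (simp add: power2_norm_eq_inner inner_diff_left inner_diff_right inner_commute) argo
    also have "\<dots> \<longleftrightarrow> c < v \<bullet> x"
    proof -
      have "v \<bullet> x = ((a - b) \<bullet> x) / r" by (simp add: v_def divide_inverse mult.commute)
      then show ?thesis using r by (simp add: c_def divide_less_cancel)
    qed
    finally show ?thesis .
  qed
  then have "hockey_stick \<gamma> (gaussian a) (gaussian b) \<le>
      measure (gaussian a) {x. c < v \<bullet> x} - \<gamma> * measure (gaussian b) {x. c < v \<bullet> x}"
    using hockey_stick_density_le[of "?p a" lborel "?p b" \<gamma>] prob_space_gaussian[of a] prob_space_gaussian[of b]
    by (simp add: gaussian_def prod_nonneg)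
  also have "\<dots> = normal_tail (c - v \<bullet> a) - \<gamma> * normal_tail (c - v \<bullet> b)"
    by (simp add: measure_gaussian_halfspace[OF v])
  \<comment> \<open>The threshold handed to the caller is \<open>c - v \<bullet> b\<close>, measured
    from the centre \<open>b\<close>; seen from \<open>a\<close> it is smaller by the distance of
    the centres.\<close>
  also have "c - v \<bullet> a = (c - v \<bullet> b) - norm (a - b)"
  proof -
    have "v \<bullet> (a - b) = r"
      using r by (simp add: v_def r_def power2_norm_eq_inner[symmetric] power2_eq_square)
    then show ?thesis by (simp add: inner_diff_right r_def)
  qed
  finally show ?thesis by (rule that)
qed

text \<open>With the threshold of the half-space held fixed, a larger distance raises the first tail
  and leaves the second alone. The resulting difference is realised by a half-space in direction
  \<open>u\<close> for the centres \<open>r *\<^sub>R u\<close> and 0. This gives independence of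
  the direction and monotonicity in one stroke.\<close>

lemma hockey_stick_gaussian_le_theta:
  fixes a b u :: "'a::euclidean_space"
  assumes u: "norm u = 1" and \<gamma>: "1 \<le> \<gamma>" and r: "norm (a - b) \<le> r"
  shows "hockey_stick \<gamma> (gaussian a) (gaussian b) \<le> theta u \<gamma> r"
proof (cases "a = b")
  \<comment> \<open>There is no direction \<open>a - b\<close> to normalise; the divergence is at
    most 0 and \<open>theta\<close> is nonnegative.\<close>
  case True
  then show ?thesis
    using hockey_stick_self_le[OF \<gamma>, of "gaussian b"] \<gamma>
      hockey_stick_nonneg[OF prob_space_gaussian, of \<gamma> "r *\<^sub>R u" "gaussian 0"]
    by (simp add: theta_def)
next
  case False
  then obtain c where "hockey_stick \<gamma> (gaussian a) (gaussian b) \<le> normal_tail (c - norm (a - b)) - \<gamma> * normal_tail c"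
    using hockey_stick_gaussian_le[of a b \<gamma>] \<gamma> by auto
  also have "\<dots> \<le> normal_tail (c - r) - \<gamma> * normal_tail c"
    using normal_tail_antimono[of "c - r" "c - norm (a - b)"] r by simp
  also have "\<dots> = measure (gaussian (r *\<^sub>R u)) {x. c < u \<bullet> x} - \<gamma> * measure (gaussian 0) {x. c < u \<bullet> x}"
    using u by (simp add: measure_gaussian_halfspace norm_eq_1)
  also have "\<dots> \<le> theta u \<gamma> r"
    unfolding theta_def using \<gamma> by (intro hockey_stick_upper prob_space_gaussian) auto
  finally show ?thesis .
qed

lemma theta_nonneg: "1 \<le> \<gamma> \<Longrightarrow> 0 \<le> theta u \<gamma> r"
  unfolding theta_def by (rule hockey_stick_nonneg[OF prob_space_gaussian]) simp

lemma theta_mono: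
  assumes "norm u = 1" "1 \<le> \<gamma>" "0 \<le> r" "r \<le> s"
  shows "theta u \<gamma> r \<le> theta u \<gamma> s"
  using hockey_stick_gaussian_le_theta[OF assms(1,2), of "r *\<^sub>R u" 0 s] assms by (simp add: theta_def)

text \<open>For distinct centres the divergence is bounded by a single normal tail, which is below
  1; for equal centres it is at most 0.\<close>

lemma theta_less_1:
  assumes "norm u = 1" "1 \<le> \<gamma>"
  shows "theta u \<gamma> r < 1"
proof (cases "r = 0")
  case True
  then show ?thesis using hockey_stick_self_le[OF assms(2), of "gaussian 0 :: 'a measure"] by (simp add: theta_def)
next
  case False
  then have "r *\<^sub>R u \<noteq> 0" using assms(1) by auto
  then obtain c where "theta u \<gamma> r \<le> normal_tail (c - norm (r *\<^sub>R u - 0)) - \<gamma> * normal_tail c"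
    using hockey_stick_gaussian_le[of "r *\<^sub>R u" 0 \<gamma>] assms(2) unfolding theta_def by auto
  moreover have "0 \<le> \<gamma> * normal_tail c" using assms(2) normal_tail_nonneg[of c] by simp
  ultimately show ?thesis using normal_tail_less_1[of "c - norm (r *\<^sub>R u - 0)"] by linarith
qed

section \<open>Contraction\<close>

text \<open>Discretising a test function \<open>\<phi>\<close> to \<open>\<lfloor>n \<phi>\<rfloor> / n\<close> turns it into an average of indicators of its
  superlevel sets, to which the definition of the hockey-stick divergence applies.\<close>

lemma integral_le_hockey_stick:
  fixes \<phi> :: "'b \<Rightarrow> real"
  assumes \<mu>: "prob_space \<mu>" and \<nu>: "prob_space \<nu>" and sets_eq[measurable_cong]: "sets \<nu> = sets \<mu>"
    and \<gamma>: "0 \<le> \<gamma>"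
    and [measurable]: "\<phi> \<in> borel_measurable \<mu>"
    and \<phi>: "\<And>x. x \<in> space \<mu> \<Longrightarrow> 0 \<le> \<phi> x" "\<And>x. x \<in> space \<mu> \<Longrightarrow> \<phi> x \<le> 1"
  shows "(\<integral>x. \<phi> x \<partial>\<mu>) - \<gamma> * (\<integral>x. \<phi> x \<partial>\<nu>) \<le> hockey_stick \<gamma> \<mu> \<nu>"
proof -
  interpret \<mu>: prob_space \<mu> by fact
  interpret \<nu>: prob_space \<nu> by fact
  have space_eq: "space \<nu> = space \<mu>" using sets_eq by (rule sets_eq_imp_space_eq)
  \<comment> \<open>The error \<open>1 / n\<close> is what rounding down to multiples of
    \<open>1 / n\<close> can lose.\<close>
  have "(\<integral>x. \<phi> x \<partial>\<mu>) - \<gamma> * (\<integral>x. \<phi> x \<partial>\<nu>) \<le> hockey_stick \<gamma> \<mu> \<nu> + 1 / real n" if n: "n > 0" for n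
  proof -
    define A where "A k = {x\<in>space \<mu>. real k \<le> real n * \<phi> x}" for k
    have A[measurable]: "A k \<in> sets \<mu>" for k unfolding A_def by measurable
    \<comment> \<open>\<open>x\<close> lies in exactly the sets \<open>A k\<close> with
      \<open>k\<close> up to the floor. Level 0, the whole space, is left out, and
      \<open>\<phi> x \<le> 1\<close> ensures that \<open>n\<close> levels suffice.\<close>
    have step: "(\<Sum>k=1..n. indicator (A k) x) = real_of_int \<lfloor>real n * \<phi> x\<rfloor>" if "x \<in> space \<mu>" for x
    proof -
      define m where "m = nat \<lfloor>real n * \<phi> x\<rfloor>"
      have m: "real m = of_int \<lfloor>real n * \<phi> x\<rfloor>" using \<phi>(1)[OF that] by (simp add: m_def)
      have "real n * \<phi> x \<le> real n" using \<phi>(2)[OF that] n by (simp add: mult_left_le)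
      then have "m \<le> n" using m by (metis floor_le_iff floor_of_nat le_floor_iff m_def nat_le_iff floor_mono)
      have "x \<in> A k \<longleftrightarrow> k \<le> m" for k
        using that \<phi>(1)[OF that] by (simp add: A_def m_def le_nat_iff le_floor_iff)
      then have "(\<Sum>k=1..n. indicator (A k) x :: real) = (\<Sum>k=1..n. if k \<in> {1..m} then 1 else 0)"
        by (intro sum.cong) (auto simp: indicator_def)
      also have "\<dots> = real (card ({1..n} \<inter> {1..m}))"
        by (subst sum.If_cases) (auto simp: Int_def)
      also have "{1..n} \<inter> {1..m} = {1..m}" using \<open>m \<le> n\<close> by auto
      finally show ?thesis using m by simp
    qed
    have int_A: "(\<integral>x. (\<Sum>k=1..n. indicator (A k) x) \<partial>\<mu>) = (\<Sum>k=1..n. measure \<mu> (A k))"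
      "(\<integral>x. (\<Sum>k=1..n. indicator (A k) x) \<partial>\<nu>) = (\<Sum>k=1..n. measure \<nu> (A k))"
    proof -
      have "A k \<in> sets \<mu>" "A k \<in> sets \<nu>" "A k \<inter> space \<mu> = A k" "A k \<inter> space \<nu> = A k" for k
        using A[of k] sets_eq space_eq by (auto simp: A_def)
      then show "(\<integral>x. (\<Sum>k=1..n. indicator (A k) x) \<partial>\<mu>) = (\<Sum>k=1..n. measure \<mu> (A k))"
        "(\<integral>x. (\<Sum>k=1..n. indicator (A k) x) \<partial>\<nu>) = (\<Sum>k=1..n. measure \<nu> (A k))"
        by (simp_all add: Bochner_Integration.integral_sum \<mu>.emeasure_eq_measure \<nu>.emeasure_eq_measure)
    qed
    have int_\<phi>: "integrable \<mu> \<phi>" "integrable \<nu> \<phi>"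
      by (auto intro!: \<mu>.integrable_const_bound[where B=1] \<nu>.integrable_const_bound[where B=1] AE_I2
          simp: space_eq \<phi>)
    have int_ind: "integrable \<mu> (\<lambda>x. \<Sum>k=1..n. indicator (A k) x :: real)"
      "integrable \<nu> (\<lambda>x. \<Sum>k=1..n. indicator (A k) x :: real)"
      using sets_eq by (auto intro!: Bochner_Integration.integrable_sum
          \<mu>.integrable_const_bound[where B=1] \<nu>.integrable_const_bound[where B=1])
    have "real n * (\<integral>x. \<phi> x \<partial>\<mu>) = (\<integral>x. real n * \<phi> x \<partial>\<mu>)" by simp
    \<comment> \<open>Bounding \<open>\<phi>\<close> from above by its rounded version costs less
      than 1 before division by \<open>n\<close>.\<close>
    also have "\<dots> \<le> (\<integral>x. (\<Sum>k=1..n. indicator (A k) x) + 1 \<partial>\<mu>)"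
    proof (rule integral_mono)
      fix x assume "x \<in> space \<mu>"
      then show "real n * \<phi> x \<le> (\<Sum>k=1..n. indicator (A k) x) + 1"
        using step[of x] by linarith
    qed (use int_\<phi> int_ind in auto)
    also have "\<dots> = (\<Sum>k=1..n. measure \<mu> (A k)) + 1"
      using int_ind by (simp only: int_A[symmetric] Bochner_Integration.integral_add \<mu>.integrable_const)
        (simp add: \<mu>.prob_space)
    finally have u: "real n * (\<integral>x. \<phi> x \<partial>\<mu>) \<le> (\<Sum>k=1..n. measure \<mu> (A k)) + 1" .
    \<comment> \<open>The integral against \<open>\<nu>\<close> enters with a negative sign, so a
      lower bound is wanted, and rounding down gives one without error.\<close>
    have "(\<Sum>k=1..n. measure \<nu> (A k)) = (\<integral>x. (\<Sum>k=1..n. indicator (A k) x) \<partial>\<nu>)" by (simp only: int_A)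
    also have "\<dots> \<le> (\<integral>x. real n * \<phi> x \<partial>\<nu>)"
    proof (rule integral_mono)
      fix x assume "x \<in> space \<nu>"
      then show "(\<Sum>k=1..n. indicator (A k) x) \<le> real n * \<phi> x"
        using step[of x] by (simp add: space_eq)
    qed (use int_\<phi> int_ind in auto)
    finally have l: "(\<Sum>k=1..n. measure \<nu> (A k)) \<le> real n * (\<integral>x. \<phi> x \<partial>\<nu>)" by simp
    have "real n * ((\<integral>x. \<phi> x \<partial>\<mu>) - \<gamma> * (\<integral>x. \<phi> x \<partial>\<nu>)) \<le>
        (\<Sum>k=1..n. measure \<mu> (A k)) + 1 - \<gamma> * (\<Sum>k=1..n. measure \<nu> (A k))"
      using u mult_left_mono[OF l \<gamma>] by (simp add: algebra_simps)
    also have "\<dots> = (\<Sum>k=1..n. measure \<mu> (A k) - \<gamma> * measure \<nu> (A k)) + 1"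
      by (simp add: sum_subtractf sum_distrib_left)
    also have "\<dots> \<le> (\<Sum>k=1..n. hockey_stick \<gamma> \<mu> \<nu>) + 1"
      by (intro add_right_mono sum_mono hockey_stick_upper \<mu> \<gamma> A)
    finally show ?thesis using n by (simp add: field_simps)
  qed
  then have "\<forall>\<^sub>F n in sequentially. (\<integral>x. \<phi> x \<partial>\<mu>) - \<gamma> * (\<integral>x. \<phi> x \<partial>\<nu>) \<le> hockey_stick \<gamma> \<mu> \<nu> + 1 / real n"
    by (auto simp: eventually_sequentially intro!: exI[of _ 1])
  moreover have "(\<lambda>n. hockey_stick \<gamma> \<mu> \<nu> + 1 / real n) \<longlonglongrightarrow> hockey_stick \<gamma> \<mu> \<nu> + 0"
    by (intro tendsto_intros lim_1_over_n)
  ultimately show ?thesis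
    by (intro tendsto_lowerbound[where F=sequentially]) auto
qed

text \<open>Rescaling \<open>\<phi>\<close> affinely from \<open>[l, s]\<close> to
  \<open>[0, 1]\<close> makes the divergence count with weight \<open>s - l\<close>, and undoing the
  shift adds \<open>(1 - \<gamma>) * l\<close>. The bound \<open>diff\<close> on pairs of points
  controls \<open>s - \<gamma> * l\<close>.\<close>

lemma integral_contraction:
  fixes \<phi> :: "'b \<Rightarrow> real"
  assumes \<mu>: "prob_space \<mu>" and \<nu>: "prob_space \<nu>" and sets_eq: "sets \<nu> = sets \<mu>"
    and \<gamma>: "1 \<le> \<gamma>"
    and meas[measurable]: "\<phi> \<in> borel_measurable \<mu>"
    and \<phi>: "\<And>x. x \<in> space \<mu> \<Longrightarrow> 0 \<le> \<phi> x" "\<And>x. x \<in> space \<mu> \<Longrightarrow> \<phi> x \<le> 1"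
    and diff: "\<And>x y. x \<in> space \<mu> \<Longrightarrow> y \<in> space \<mu> \<Longrightarrow> \<phi> x - \<gamma> * \<phi> y \<le> \<eta>"
    and \<eta>: "0 \<le> \<eta>"
  shows "(\<integral>x. \<phi> x \<partial>\<mu>) - \<gamma> * (\<integral>x. \<phi> x \<partial>\<nu>) \<le> \<eta> * hockey_stick \<gamma> \<mu> \<nu>"
proof -
  interpret \<mu>: prob_space \<mu> by fact
  interpret \<nu>: prob_space \<nu> by fact
  have meas'[measurable]: "\<phi> \<in> borel_measurable \<nu>"
    using meas sets_eq by (simp cong: measurable_cong_sets)
  have space_eq: "space \<nu> = space \<mu>" using sets_eq by (rule sets_eq_imp_space_eq)
  define e where "e = hockey_stick \<gamma> \<mu> \<nu>"
  have e: "0 \<le> e" "e \<le> 1"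
    using hockey_stick_nonneg[OF \<mu>, of \<gamma> \<nu>] hockey_stick_le_1[OF \<mu>, of \<gamma> \<nu>] \<gamma> by (auto simp: e_def)
  define l where "l = (INF x\<in>space \<mu>. \<phi> x)"
  define s where "s = (SUP x\<in>space \<mu>. \<phi> x)"
  have bdd: "bdd_below (\<phi> ` space \<mu>)" "bdd_above (\<phi> ` space \<mu>)"
    using \<phi> by (auto intro!: bdd_belowI2 bdd_aboveI2)
  have l: "l \<le> \<phi> x" and s: "\<phi> x \<le> s" if "x \<in> space \<mu>" for x
    using that bdd by (auto simp: l_def s_def intro: cINF_lower cSUP_upper)
  have "0 \<le> l" unfolding l_def using \<phi>(1) \<mu>.not_empty by (intro cINF_greatest) auto
  have "l \<le> s" using l s \<mu>.not_empty by (meson ex_in_conv order_trans)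
  have sl: "s - \<gamma> * l \<le> \<eta>"
  proof -
    have "s - \<gamma> * \<phi> y \<le> \<eta>" if y: "y \<in> space \<mu>" for y
    proof -
      have "s \<le> \<eta> + \<gamma> * \<phi> y" unfolding s_def
        by (rule cSUP_least[OF \<mu>.not_empty]) (use diff[OF _ y] in \<open>auto simp: algebra_simps\<close>)
      then show ?thesis by simp
    qed
    \<comment> \<open>Solved for \<open>\<phi> y\<close>, the inequality passes to the infimum over
      \<open>y\<close>.\<close>
    then have "(s - \<eta>) / \<gamma> \<le> \<phi> y" if y: "y \<in> space \<mu>" for y
      using that \<gamma> by (force simp: field_simps)
    then have "(s - \<eta>) / \<gamma> \<le> l" unfolding l_def by (intro cINF_greatest \<mu>.not_empty)
    then show ?thesis using \<gamma> by (simp add: field_simps)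
  qed
  have int_\<phi>: "integrable \<mu> \<phi>" "integrable \<nu> \<phi>"
    by (auto intro!: \<mu>.integrable_const_bound[where B=1] \<nu>.integrable_const_bound[where B=1] AE_I2
        simp: space_eq \<phi>)
  have "(\<integral>x. \<phi> x \<partial>\<mu>) - \<gamma> * (\<integral>x. \<phi> x \<partial>\<nu>) \<le> (s - l) * e + (1 - \<gamma>) * l"
  proof (cases "l = s")
    \<comment> \<open>Rescaling would divide by 0, but here \<open>\<phi>\<close> is constant and
      both sides are \<open>(1 - \<gamma>) * l\<close>.\<close>
    case True
    then have eq: "\<phi> x = l" if "x \<in> space \<mu>" for x using l[OF that] s[OF that] by simp
    have "(\<integral>x. \<phi> x \<partial>\<mu>) = (\<integral>x. l \<partial>\<mu>)" "(\<integral>x. \<phi> x \<partial>\<nu>) = (\<integral>x. l \<partial>\<nu>)"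
      by (intro Bochner_Integration.integral_cong; simp add: eq space_eq)+
    then show ?thesis
      using True by (simp add: \<mu>.prob_space \<nu>.prob_space algebra_simps)
  next
    case False
    with \<open>l \<le> s\<close> have "l < s" by simp
    define \<psi> where "\<psi> x = (\<phi> x - l) / (s - l)" for x
    have "(\<integral>x. \<psi> x \<partial>\<mu>) - \<gamma> * (\<integral>x. \<psi> x \<partial>\<nu>) \<le> e"
      unfolding e_def using \<open>l < s\<close> l s \<gamma>
      by (intro integral_le_hockey_stick \<mu> \<nu> sets_eq) (auto simp: \<psi>_def field_simps)
    moreover have "(\<integral>x. \<psi> x \<partial>\<mu>) = ((\<integral>x. \<phi> x \<partial>\<mu>) - l) / (s - l)"
      "(\<integral>x. \<psi> x \<partial>\<nu>) = ((\<integral>x. \<phi> x \<partial>\<nu>) - l) / (s - l)"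
      using int_\<phi> by (simp_all add: \<psi>_def \<mu>.prob_space \<nu>.prob_space)
    ultimately have "((\<integral>x. \<phi> x \<partial>\<mu>) - l) / (s - l) - \<gamma> * (((\<integral>x. \<phi> x \<partial>\<nu>) - l) / (s - l)) \<le> e"
      by simp
    then have "((\<integral>x. \<phi> x \<partial>\<mu>) - l) - \<gamma> * ((\<integral>x. \<phi> x \<partial>\<nu>) - l) \<le> e * (s - l)"
      using \<open>l < s\<close> by (simp add: divide_simps split: if_splits)
    then show ?thesis by (simp add: algebra_simps)
  qed
  \<comment> \<open>The subtracted term is nonnegative because \<open>\<gamma> \<ge> 1\<close>,
    \<open>e \<le> 1\<close> and \<open>l \<ge> 0\<close>.\<close>
  also have "\<dots> = (s - \<gamma> * l) * e - (\<gamma> - 1) * (1 - e) * l"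
    by (simp add: algebra_simps)
  also have "\<dots> \<le> (s - \<gamma> * l) * e"
    using \<gamma> e \<open>0 \<le> l\<close> by simp
  also have "\<dots> \<le> \<eta> * e"
    using sl e by (intro mult_right_mono) auto
  finally show ?thesis by (simp add: e_def)
qed

section \<open>The noisy iteration\<close>

text \<open>The first \<open>t\<close> steps read only the first \<open>t\<close> costs and noises.
  This allows later noise coordinates to be altered and collections to be compared before they
  differ.\<close>

lemma iterate_cong:
  assumes "\<And>j. j \<in> {1..t} \<Longrightarrow> g j = h j" "\<And>j. j \<in> {1..t} \<Longrightarrow> z j = y j"
  shows "iterate W \<Psi> \<sigma> g w z t = iterate W \<Psi> \<sigma> h w y t"
  using assms by (induction t) auto

text \<open>Only the initial law is fixed here: laws at fixed times live on the canonical product of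
  \<open>\<mu>1\<close> and the noise. Concrete random variables enter in
  \<open>measure_stopped_law\<close>.\<close>

locale noisy_iteration =
  fixes W :: "'a::euclidean_space set" and F :: "'c set" and \<Psi> :: "'c \<Rightarrow> 'a \<Rightarrow> 'a"
    and \<sigma> :: "nat \<Rightarrow> real" and n :: nat and \<mu>1 :: "'a measure"
  assumes closed_W: "closed W" and convex_W: "convex W"
    and Psi_measurable: "g \<in> F \<Longrightarrow> \<Psi> g \<in> borel_measurable (restrict_space borel W)"
    and sigma_pos: "t \<in> {1..n} \<Longrightarrow> 0 < \<sigma> t"
    and prob_mu1: "prob_space \<mu>1"
    and sets_mu1 [measurable_cong]: "sets \<mu>1 = sets (restrict_space borel W)"
begin

abbreviation noise :: "(nat \<Rightarrow> 'a) measure" where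
  "noise \<equiv> \<Pi>\<^sub>M t\<in>{1..n}. gaussian 0"

lemma space_mu1: "space \<mu>1 = W"
  using sets_eq_imp_space_eq[OF sets_mu1] by (simp add: space_restrict_space)

lemma W_nonempty: "W \<noteq> {}"
  using prob_space.not_empty[OF prob_mu1] by (simp add: space_mu1)

text \<open>Projection onto a nonempty closed convex set is continuous.\<close>

lemma closest_point_measurable [measurable]:
  "closest_point W \<in> borel \<rightarrow>\<^sub>M restrict_space borel W"
  by (intro measurable_restrict_space2 borel_measurable_continuous_onI
      continuous_on_closest_point convex_W closed_W W_nonempty)
    (simp add: closest_point_in_set closed_W W_nonempty)

lemma step_measurable:
  assumes "g \<in> F"
  shows "(\<lambda>(w, x). closest_point W (\<Psi> g w + s *\<^sub>R x)) \<in>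
    restrict_space borel W \<Otimes>\<^sub>M borel \<rightarrow>\<^sub>M restrict_space borel W"
  using Psi_measurable[OF assms, measurable] by measurable

lemma iterate_measurable:
  assumes g: "g \<in> {1..n} \<rightarrow> F" and "t \<le> n"
  shows "(\<lambda>(w, z). iterate W \<Psi> \<sigma> g w z t) \<in> \<mu>1 \<Otimes>\<^sub>M noise \<rightarrow>\<^sub>M restrict_space borel W"
  using \<open>t \<le> n\<close>
proof (induction t)
  case 0
  then show ?case
    using measurable_fst[of \<mu>1 noise]
    by (simp add: case_prod_beta' cong: measurable_cong_sets[OF refl sets_mu1])
next
  case (Suc t)
  then have IH: "(\<lambda>(w, z). iterate W \<Psi> \<sigma> g w z t) \<in> \<mu>1 \<Otimes>\<^sub>M noise \<rightarrow>\<^sub>M restrict_space borel W"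
    and t: "Suc t \<in> {1..n}" by auto
  have "(\<lambda>p. snd p (Suc t)) \<in> \<mu>1 \<Otimes>\<^sub>M noise \<rightarrow>\<^sub>M borel"
    using measurable_compose[OF measurable_snd measurable_component_singleton[OF t, where M="\<lambda>_. gaussian 0"]]
    by (simp cong: measurable_cong_sets)
  then have "(\<lambda>p. (iterate W \<Psi> \<sigma> g (fst p) (snd p) t, snd p (Suc t))) \<in>
      \<mu>1 \<Otimes>\<^sub>M noise \<rightarrow>\<^sub>M restrict_space borel W \<Otimes>\<^sub>M borel"
    using IH by (intro measurable_Pair) (simp_all add: case_prod_beta')
  from measurable_compose[OF this step_measurable[of "g (Suc t)" "\<sigma> (Suc t)"]] g t
  show ?case by (simp add: case_prod_beta' Pi_iff)
qed

lemma prob_space_noise: "prob_space noise"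
  by (intro prob_space_PiM prob_space_gaussian)

lemma prob_space_mu1_noise: "prob_space (\<mu>1 \<Otimes>\<^sub>M noise)"
proof -
  interpret mu1: prob_space \<mu>1 by (rule prob_mu1)
  interpret noise: prob_space noise by (rule prob_space_noise)
  interpret pair_prob_space \<mu>1 noise ..
  show ?thesis by (rule prob_space_axioms)
qed

text \<open>As for \<open>iterate\<close>, the index counts steps: \<open>law g t\<close> is the law of the iterate at time \<open>t + 1\<close>.\<close>

definition law :: "(nat \<Rightarrow> 'c) \<Rightarrow> nat \<Rightarrow> 'a measure" where
  "law g t = distr (\<mu>1 \<Otimes>\<^sub>M noise) (restrict_space borel W) (\<lambda>(w, z). iterate W \<Psi> \<sigma> g w z t)"

lemma sets_law [simp, measurable_cong]: "sets (law g t) = sets (restrict_space borel W)"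
  and space_law [simp]: "space (law g t) = W"
  by (simp_all add: law_def space_restrict_space)

lemma prob_space_law: "g \<in> {1..n} \<rightarrow> F \<Longrightarrow> t \<le> n \<Longrightarrow> prob_space (law g t)"
  unfolding law_def by (intro prob_space.prob_space_distr prob_space_mu1_noise iterate_measurable)

lemma law_cong:
  assumes "\<And>j. j \<in> {1..t} \<Longrightarrow> g j = h j"
  shows "law g t = law h t"
proof -
  have "iterate W \<Psi> \<sigma> g w z t = iterate W \<Psi> \<sigma> h w z t" for w z
    using assms by (intro iterate_cong) auto
  then show ?thesis by (simp add: law_def)
qed

lemma nn_integral_law:
  assumes g: "g \<in> {1..n} \<rightarrow> F" and t: "t \<le> n"
    and f: "f \<in> borel_measurable (restrict_space borel W)"
  shows "(\<integral>\<^sup>+v. f v \<partial>law g t) = (\<integral>\<^sup>+w. \<integral>\<^sup>+z. f (iterate W \<Psi> \<sigma> g w z t) \<partial>noise \<partial>\<mu>1)"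
proof -
  interpret noise: prob_space noise by (rule prob_space_noise)
  note m = iterate_measurable[OF g t]
  have "(\<integral>\<^sup>+v. f v \<partial>law g t) = (\<integral>\<^sup>+p. f (case p of (w, z) \<Rightarrow> iterate W \<Psi> \<sigma> g w z t) \<partial>(\<mu>1 \<Otimes>\<^sub>M noise))"
    unfolding law_def by (rule nn_integral_distr[OF m]) (use f in simp)
  also have "\<dots> = (\<integral>\<^sup>+w. \<integral>\<^sup>+z. f (case (w, z) of (w, z) \<Rightarrow> iterate W \<Psi> \<sigma> g w z t) \<partial>noise \<partial>\<mu>1)"
    by (rule noise.nn_integral_fst[symmetric]) (rule measurable_compose[OF m f])
  finally show ?thesis by simp
qed

section \<open>The Markov kernel of one noisy step\<close>

definition kernel :: "'c \<Rightarrow> real \<Rightarrow> 'a set \<Rightarrow> 'a \<Rightarrow> real" where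
  "kernel g s A w = measure (gaussian 0) {x. closest_point W (\<Psi> g w + s *\<^sub>R x) \<in> A}"

lemma kernel_bounds: "0 \<le> kernel g s A w" "kernel g s A w \<le> 1"
  by (auto simp: kernel_def prob_space.prob_le_1[OF prob_space_gaussian])

text \<open>The form in which the kernel arises when one noise coordinate is integrated out.\<close>

lemma ennreal_kernel:
  assumes g: "g \<in> F" and w: "w \<in> W" and A: "A \<in> sets (restrict_space borel W)"
  shows "ennreal (kernel g s A w) = (\<integral>\<^sup>+x. indicator A (closest_point W (\<Psi> g w + s *\<^sub>R x)) \<partial>gaussian 0)"
proof -
  have [measurable]: "(\<lambda>x. closest_point W (\<Psi> g w + s *\<^sub>R x)) \<in> borel \<rightarrow>\<^sub>M restrict_space borel W"
    by measurable
  have [measurable]: "{x. closest_point W (\<Psi> g w + s *\<^sub>R x) \<in> A} \<in> sets borel"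
    using A by measurable
  have "(\<integral>\<^sup>+x. indicator A (closest_point W (\<Psi> g w + s *\<^sub>R x)) \<partial>gaussian 0) =
      (\<integral>\<^sup>+x. indicator {x. closest_point W (\<Psi> g w + s *\<^sub>R x) \<in> A} x \<partial>gaussian 0)"
    by (intro nn_integral_cong) (auto simp: indicator_def)
  also have "\<dots> = emeasure (gaussian 0) {x. closest_point W (\<Psi> g w + s *\<^sub>R x) \<in> A}"
    by (rule nn_integral_indicator) simp
  also have "\<dots> = ennreal (kernel g s A w)"
    unfolding kernel_def
    by (rule finite_measure.emeasure_eq_measure[OF prob_space.finite_measure[OF prob_space_gaussian]])
  finally show ?thesis by simp
qed

text \<open>Partial integrals of a jointly measurable nonnegative function are measurable.\<close>

lemma kernel_measurable:
  assumes g: "g \<in> F" and A[measurable]: "A \<in> sets (restrict_space borel W)"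
  shows "kernel g s A \<in> borel_measurable (restrict_space borel W)"
proof -
  interpret prob_space "gaussian 0 :: 'a measure" by (rule prob_space_gaussian)
  note [measurable] = step_measurable[OF g, of s]
  have "(\<lambda>p. indicator A (case p of (w, x) \<Rightarrow> closest_point W (\<Psi> g w + s *\<^sub>R x)) :: ennreal) \<in>
      borel_measurable (restrict_space borel W \<Otimes>\<^sub>M gaussian 0)"
    by measurable
  then have "(\<lambda>w. \<integral>\<^sup>+x. indicator A (closest_point W (\<Psi> g w + s *\<^sub>R x)) \<partial>gaussian 0) \<in>
      borel_measurable (restrict_space borel W)"
    by (auto dest: borel_measurable_nn_integral_fst)
  then have "(\<lambda>w. enn2real (\<integral>\<^sup>+x. indicator A (closest_point W (\<Psi> g w + s *\<^sub>R x)) \<partial>gaussian 0)) \<in>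
      borel_measurable (restrict_space borel W)"
    by measurable
  \<comment> \<open>The real-valued integral is identified with the kernel only at points of
    \<open>W\<close>, which is the whole restricted space.\<close>
  then show ?thesis
    by (rule measurable_cong[THEN iffD1, rotated])
      (simp add: ennreal_kernel[OF g _ A, symmetric] kernel_bounds space_restrict_space)
qed

text \<open>Both kernels are push-forwards of unit Gaussians under the same map
  \<open>y \<mapsto> closest_point W (s *\<^sub>R y)\<close>, with centres at distance at most
  \<open>r / s\<close>. Allowing two costs and two points covers both the step where the collections
  differ and the later contracting steps.\<close>

lemma kernel_diff_le_theta:
  fixes u :: 'a
  assumes s: "0 < s"
    and A[measurable]: "A \<in> sets (restrict_space borel W)"
    and u: "norm u = 1" and \<gamma>: "1 \<le> \<gamma>" and r: "norm (\<Psi> g w - \<Psi> h v) \<le> r"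
  shows "kernel g s A w - \<gamma> * kernel h s A v \<le> theta u \<gamma> (r / s)"
proof -
  define B where "B = {y. closest_point W (s *\<^sub>R y) \<in> A}"
  have [measurable]: "(\<lambda>y. closest_point W (s *\<^sub>R y)) \<in> borel \<rightarrow>\<^sub>M restrict_space borel W"
    by measurable
  have B[measurable]: "B \<in> sets borel" unfolding B_def by measurable
  have k: "kernel f s A x = measure (gaussian (\<Psi> f x /\<^sub>R s)) B" for f x
  proof -
    have "measure (gaussian (\<Psi> f x /\<^sub>R s)) B = measure (distr (gaussian 0) borel (\<lambda>y. \<Psi> f x /\<^sub>R s + y)) B"
      by (simp add: distr_gaussian_translate)
    also have "\<dots> = measure (gaussian 0) {y. \<Psi> f x /\<^sub>R s + y \<in> B}"
      by (subst measure_distr) (auto simp: vimage_def)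
    finally show ?thesis
      using s by (simp add: kernel_def B_def scaleR_add_right)
  qed
  have "kernel g s A w - \<gamma> * kernel h s A v \<le> hockey_stick \<gamma> (gaussian (\<Psi> g w /\<^sub>R s)) (gaussian (\<Psi> h v /\<^sub>R s))"
    unfolding k using \<gamma> by (intro hockey_stick_upper prob_space_gaussian) auto
  also have "\<dots> \<le> theta u \<gamma> (r / s)"
  proof (rule hockey_stick_gaussian_le_theta[OF u \<gamma>])
    have "norm (\<Psi> g w /\<^sub>R s - \<Psi> h v /\<^sub>R s) = norm (\<Psi> g w - \<Psi> h v) / s"
      using s by (simp add: scaleR_diff_right[symmetric] divide_inverse mult.commute)
    then show "norm (\<Psi> g w /\<^sub>R s - \<Psi> h v /\<^sub>R s) \<le> r / s"
      using r s by (simp add: divide_right_mono)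
  qed
  finally show ?thesis .
qed

text \<open>Chapman-Kolmogorov: the iterate after \<open>t\<close> steps does not involve noise
  coordinate \<open>Suc t\<close>, so integrating that coordinate first produces the kernel.\<close>

lemma measure_law_Suc:
  assumes g: "g \<in> {1..n} \<rightarrow> F" and t: "Suc t \<le> n"
    and A[measurable]: "A \<in> sets (restrict_space borel W)"
  shows "measure (law g (Suc t)) A = (\<integral>v. kernel (g (Suc t)) (\<sigma> (Suc t)) A v \<partial>law g t)"
proof -
  interpret G: product_sigma_finite "\<lambda>_::nat. gaussian 0 :: 'a measure"
    by (simp add: product_sigma_finite_def prob_space_gaussian prob_space_imp_sigma_finite)
  interpret G0: prob_space "gaussian 0 :: 'a measure" by (rule prob_space_gaussian)
  interpret L: prob_space "law g (Suc t)" using g t by (rule prob_space_law)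
  interpret L0: prob_space "law g t" using g t by (intro prob_space_law) auto
  let ?k = "kernel (g (Suc t)) (\<sigma> (Suc t)) A"
  have gt: "g (Suc t) \<in> F" using g t by auto
  note k[measurable] = kernel_measurable[OF gt A, of "\<sigma> (Suc t)"]
  define J where "J = {1..n} - {Suc t}"
  have J: "{1..n} = insert (Suc t) J" "finite J" "Suc t \<notin> J" using t by (auto simp: J_def)
  have upd: "iterate W \<Psi> \<sigma> g w (z(Suc t := x)) t = iterate W \<Psi> \<sigma> g w z t" for w z x
    by (rule iterate_cong) auto
  have insert: "(\<integral>\<^sup>+z. f (iterate W \<Psi> \<sigma> g w z s) \<partial>noise) =
      (\<integral>\<^sup>+z. \<integral>\<^sup>+x. f (iterate W \<Psi> \<sigma> g w (z(Suc t := x)) s) \<partial>gaussian 0 \<partial>(\<Pi>\<^sub>M i\<in>J. gaussian 0))"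
    if f: "f \<in> borel_measurable (restrict_space borel W)" and w: "w \<in> W" and s: "s \<le> n"
    for f :: "'a \<Rightarrow> ennreal" and w s
  proof -
    have "(\<lambda>z. f (iterate W \<Psi> \<sigma> g w z s)) \<in> borel_measurable noise"
      using measurable_compose[OF measurable_Pair1' measurable_compose[OF iterate_measurable[OF g s] f], of w]
        w by (simp add: space_mu1)
    then show ?thesis
      unfolding J(1) by (rule G.product_nn_integral_insert[OF J(2,3)])
  qed
  have iter_W: "iterate W \<Psi> \<sigma> g w z s \<in> W" if "w \<in> W" for w z s
    using that closest_point_in_set[OF closed_W W_nonempty] by (cases s) auto
  have "emeasure (law g (Suc t)) A = (\<integral>\<^sup>+v. indicator A v \<partial>law g (Suc t))"
    by (rule nn_integral_indicator[symmetric]) simp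
  also have "\<dots> = (\<integral>\<^sup>+w. \<integral>\<^sup>+z. indicator A (iterate W \<Psi> \<sigma> g w z (Suc t)) \<partial>noise \<partial>\<mu>1)"
    using t by (intro nn_integral_law g) auto
  also have "\<dots> = (\<integral>\<^sup>+w. \<integral>\<^sup>+z. ennreal (?k (iterate W \<Psi> \<sigma> g w z t)) \<partial>noise \<partial>\<mu>1)"
  proof (rule nn_integral_cong)
    fix w assume "w \<in> space \<mu>1"
    then have w: "w \<in> W" by (simp add: space_mu1)
    have "(\<integral>\<^sup>+z. indicator A (iterate W \<Psi> \<sigma> g w z (Suc t)) \<partial>noise) =
        (\<integral>\<^sup>+z. \<integral>\<^sup>+x. indicator A (iterate W \<Psi> \<sigma> g w (z(Suc t := x)) (Suc t)) \<partial>gaussian 0 \<partial>(\<Pi>\<^sub>M i\<in>J. gaussian 0))"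
      using w t by (intro insert) auto
    also have "\<dots> = (\<integral>\<^sup>+z. ennreal (?k (iterate W \<Psi> \<sigma> g w z t)) \<partial>(\<Pi>\<^sub>M i\<in>J. gaussian 0))"
      by (simp add: upd ennreal_kernel[OF gt iter_W[OF w] A])
    \<comment> \<open>The integrand is constant in \<open>x\<close> and the Gaussian has mass 1, so
      the missing coordinate can be put back to recover the full noise measure.\<close>
    also have "\<dots> = (\<integral>\<^sup>+z. \<integral>\<^sup>+x. ennreal (?k (iterate W \<Psi> \<sigma> g w (z(Suc t := x)) t)) \<partial>gaussian 0 \<partial>(\<Pi>\<^sub>M i\<in>J. gaussian 0))"
      unfolding upd using G0.emeasure_space_1 by (simp del: space_gaussian)
    also have "\<dots> = (\<integral>\<^sup>+z. ennreal (?k (iterate W \<Psi> \<sigma> g w z t)) \<partial>noise)"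
      using w t by (intro insert[of "\<lambda>v. ennreal (?k v)", symmetric]) auto
    finally show "(\<integral>\<^sup>+z. indicator A (iterate W \<Psi> \<sigma> g w z (Suc t)) \<partial>noise) =
      (\<integral>\<^sup>+z. ennreal (?k (iterate W \<Psi> \<sigma> g w z t)) \<partial>noise)" .
  qed
  also have "\<dots> = (\<integral>\<^sup>+v. ennreal (?k v) \<partial>law g t)"
    using t by (intro nn_integral_law[symmetric] g) auto
  also have "\<dots> = ennreal (\<integral>v. ?k v \<partial>law g t)"
    by (intro nn_integral_eq_integral L0.integrable_const_bound[where B=1])
      (auto simp: kernel_bounds)
  finally show ?thesis
    by (simp add: L.emeasure_eq_measure kernel_bounds integral_nonneg)
qed

end

text \<open>Rectangles determine the product measure, and on them independence is the product
  formula.\<close>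

lemma indep_rvs_distr:
  assumes "prob_space M" and indep: "indep_rvs M N X N' Y"
  shows "distr M (N \<Otimes>\<^sub>M N') (\<lambda>\<omega>. (X \<omega>, Y \<omega>)) = distr M N X \<Otimes>\<^sub>M distr M N' Y"
proof -
  interpret prob_space M by fact
  have X[measurable]: "X \<in> M \<rightarrow>\<^sub>M N" and Y[measurable]: "Y \<in> M \<rightarrow>\<^sub>M N'"
    and ind: "indep_set {X -` A \<inter> space M |A. A \<in> sets N} {Y -` B \<inter> space M |B. B \<in> sets N'}"
    using indep by (auto simp: indep_rvs_def)
  interpret X: prob_space "distr M N X" by (rule prob_space_distr) fact
  interpret Y: prob_space "distr M N' Y" by (rule prob_space_distr) fact
  show ?thesis
  proof (rule pair_measure_eqI[symmetric])
    fix A B assume "A \<in> sets (distr M N X)" "B \<in> sets (distr M N' Y)"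
    then have A[measurable]: "A \<in> sets N" and B[measurable]: "B \<in> sets N'" by auto
    have "emeasure (distr M (N \<Otimes>\<^sub>M N') (\<lambda>\<omega>. (X \<omega>, Y \<omega>))) (A \<times> B) =
        emeasure M ((X -` A \<inter> space M) \<inter> (Y -` B \<inter> space M))"
      by (subst emeasure_distr) (auto intro!: arg_cong2[where f=emeasure])
    also have "\<dots> = emeasure M (X -` A \<inter> space M) * emeasure M (Y -` B \<inter> space M)"
    proof -
      have "prob ((X -` A \<inter> space M) \<inter> (Y -` B \<inter> space M)) = prob (X -` A \<inter> space M) * prob (Y -` B \<inter> space M)"
        by (rule indep_setD[OF ind]) (use A B in auto)
      then show ?thesis by (simp add: emeasure_eq_measure ennreal_mult)
    qed
    finally show "emeasure (distr M N X) A * emeasure (distr M N' Y) B =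
        emeasure (distr M (N \<Otimes>\<^sub>M N') (\<lambda>\<omega>. (X \<omega>, Y \<omega>))) (A \<times> B)"
      by (simp add: emeasure_distr)
  qed (auto simp: X.sigma_finite_measure_axioms Y.sigma_finite_measure_axioms)
qed

section \<open>Divergence along the iteration, and the stopped law as a mixture\<close>

context noisy_iteration
begin

text \<open>Both laws pass through the same kernel, and two starting points are moved by
  \<open>\<Psi>\<close> to points no farther apart than the diameter of its image, so
  \<open>integral_contraction\<close> applies.\<close>

lemma hockey_stick_law_Suc_le:
  fixes u :: 'a
  assumes gh: "g \<in> {1..n} \<rightarrow> F" "h \<in> {1..n} \<rightarrow> F" and t: "Suc t \<le> n" and eq: "g (Suc t) = h (Suc t)"
    and u: "norm u = 1" and \<gamma>: "1 \<le> \<gamma>"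
    and bdd: "bounded (\<Psi> (g (Suc t)) ` W)"
  shows "hockey_stick \<gamma> (law g (Suc t)) (law h (Suc t)) \<le>
    theta u \<gamma> (diameter (\<Psi> (g (Suc t)) ` W) / \<sigma> (Suc t)) * hockey_stick \<gamma> (law g t) (law h t)"
proof (rule hockey_stick_least)
  fix A assume "A \<in> sets (law g (Suc t))"
  then have A: "A \<in> sets (restrict_space borel W)" by simp
  have gF: "g (Suc t) \<in> F" and \<sigma>: "0 < \<sigma> (Suc t)" using gh t sigma_pos by auto
  let ?k = "kernel (g (Suc t)) (\<sigma> (Suc t)) A"
  have "measure (law g (Suc t)) A - \<gamma> * measure (law h (Suc t)) A =
      (\<integral>v. ?k v \<partial>law g t) - \<gamma> * (\<integral>v. ?k v \<partial>law h t)"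
    using gh t A by (simp add: measure_law_Suc eq)
  also have "\<dots> \<le> theta u \<gamma> (diameter (\<Psi> (g (Suc t)) ` W) / \<sigma> (Suc t)) * hockey_stick \<gamma> (law g t) (law h t)"
  proof (rule integral_contraction)
    show "prob_space (law g t)" "prob_space (law h t)" using t by (auto intro!: prob_space_law gh simp del: One_nat_def)
    show "?k \<in> borel_measurable (law g t)"
      using kernel_measurable[OF gF A] by simp
    fix x y assume "x \<in> space (law g t)" "y \<in> space (law g t)"
    then have xy: "x \<in> W" "y \<in> W" by auto
    have "norm (\<Psi> (g (Suc t)) x - \<Psi> (g (Suc t)) y) \<le> diameter (\<Psi> (g (Suc t)) ` W)"
      using diameter_bounded_bound[OF bdd, of "\<Psi> (g (Suc t)) x" "\<Psi> (g (Suc t)) y"] xy by (auto simp: dist_norm)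
    then show "?k x - \<gamma> * ?k y \<le> theta u \<gamma> (diameter (\<Psi> (g (Suc t)) ` W) / \<sigma> (Suc t))"
      by (rule kernel_diff_le_theta[OF \<sigma> A u \<gamma>])
  qed (use \<gamma> in \<open>auto simp: kernel_bounds theta_nonneg\<close>)
  finally show "measure (law g (Suc t)) A - \<gamma> * measure (law h (Suc t)) A \<le>
    theta u \<gamma> (diameter (\<Psi> (g (Suc t)) ` W) / \<sigma> (Suc t)) * hockey_stick \<gamma> (law g t) (law h t)" .
qed

text \<open>Here the incoming law is common and the kernels differ, so the pointwise bound on the
  kernels is integrated against that law.\<close>

lemma hockey_stick_law_Suc_le_of_eq:
  fixes u :: 'a
  assumes gh: "g \<in> {1..n} \<rightarrow> F" "h \<in> {1..n} \<rightarrow> F" and t: "Suc t \<le> n" and eq: "law g t = law h t"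
    and u: "norm u = 1" and \<gamma>: "1 \<le> \<gamma>"
    and r: "\<And>w. w \<in> W \<Longrightarrow> norm (\<Psi> (g (Suc t)) w - \<Psi> (h (Suc t)) w) \<le> r"
  shows "hockey_stick \<gamma> (law g (Suc t)) (law h (Suc t)) \<le> theta u \<gamma> (r / \<sigma> (Suc t))"
proof (rule hockey_stick_least)
  interpret prob_space "law h t" using gh t by (intro prob_space_law) auto
  fix A assume "A \<in> sets (law g (Suc t))"
  then have A: "A \<in> sets (restrict_space borel W)" by simp
  have F: "g (Suc t) \<in> F" "h (Suc t) \<in> F" and \<sigma>: "0 < \<sigma> (Suc t)" using gh t sigma_pos by auto
  let ?k = "\<lambda>f. kernel (f (Suc t)) (\<sigma> (Suc t)) A"
  have int: "integrable (law h t) (kernel f (\<sigma> (Suc t)) A)" if "f \<in> F" for f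
    using kernel_measurable[OF that A]
    by (intro integrable_const_bound[where B=1]) (auto simp: kernel_bounds)
  have "measure (law g (Suc t)) A - \<gamma> * measure (law h (Suc t)) A =
      (\<integral>v. ?k g v \<partial>law h t) - \<gamma> * (\<integral>v. ?k h v \<partial>law h t)"
    using gh t A by (simp add: measure_law_Suc eq)
  also have "\<dots> = (\<integral>v. ?k g v - \<gamma> * ?k h v \<partial>law h t)"
    using int[OF F(1)] int[OF F(2)] by simp
  also have "\<dots> \<le> (\<integral>v. theta u \<gamma> (r / \<sigma> (Suc t)) \<partial>law h t)"
  proof (rule integral_mono)
    fix w assume "w \<in> space (law h t)"
    then have "w \<in> W" by simp
    then show "?k g w - \<gamma> * ?k h w \<le> theta u \<gamma> (r / \<sigma> (Suc t))"
      by (intro kernel_diff_le_theta \<sigma> A u \<gamma> r)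
  qed (use int[OF F(1)] int[OF F(2)] in auto)
  also have "\<dots> = theta u \<gamma> (r / \<sigma> (Suc t))" using prob_space by simp
  finally show "measure (law g (Suc t)) A - \<gamma> * measure (law h (Suc t)) A \<le> theta u \<gamma> (r / \<sigma> (Suc t))" .
qed

text \<open>Induction starts at \<open>t = i\<close>, where the product is empty and the differing
  step creates the divergence; each later step contributes one contraction factor.\<close>

lemma hockey_stick_law_le:
  fixes u :: 'a
  assumes gh: "g \<in> {1..n} \<rightarrow> F" "h \<in> {1..n} \<rightarrow> F" and i: "i \<in> {1..n}"
    and eq: "\<And>t. t \<in> {1..n} - {i} \<Longrightarrow> g t = h t"
    and u: "norm u = 1" and \<gamma>: "1 \<le> \<gamma>"
    and r: "\<And>w. w \<in> W \<Longrightarrow> norm (\<Psi> (g i) w - \<Psi> (h i) w) \<le> r"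
    and bdd: "\<And>t. t \<in> {1..n} \<Longrightarrow> bounded (\<Psi> (g t) ` W)"
    and t: "i \<le> t" "t \<le> n"
  shows "hockey_stick \<gamma> (law g t) (law h t) \<le>
    theta u \<gamma> (r / \<sigma> i) * (\<Prod>j=i+1..t. theta u \<gamma> (diameter (\<Psi> (g j) ` W) / \<sigma> j))"
  using t
proof (induction t rule: dec_induct)
  case base
  \<comment> \<open>Step \<open>i\<close> starts from the law after \<open>k = i - 1\<close> steps,
    which uses only indices on which the collections agree.\<close>
  obtain k where k: "i = Suc k" using i by (cases i) auto
  have "law g k = law h k" using i k by (intro law_cong eq) auto
  then show ?case
    using hockey_stick_law_Suc_le_of_eq[OF gh _ _ u \<gamma>, of k r] r i by (simp add: k)
next
  case (step t)
  let ?\<theta> = "\<lambda>j. theta u \<gamma> (diameter (\<Psi> (g j) ` W) / \<sigma> j)"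
  have "hockey_stick \<gamma> (law g (Suc t)) (law h (Suc t)) \<le> ?\<theta> (Suc t) * hockey_stick \<gamma> (law g t) (law h t)"
    using step i by (intro hockey_stick_law_Suc_le gh eq u \<gamma> bdd) auto
  also have "\<dots> \<le> ?\<theta> (Suc t) * (theta u \<gamma> (r / \<sigma> i) * (\<Prod>j=i+1..t. ?\<theta> j))"
    using step theta_nonneg[OF \<gamma>] by (intro mult_left_mono) auto
  also have "\<dots> = theta u \<gamma> (r / \<sigma> i) * (\<Prod>j=i+1..Suc t. ?\<theta> j)"
    using step by (simp add: prod.nat_ivl_Suc')
  finally show ?case .
qed

text \<open>Independence transfers the process to the product of \<open>\<mu>1\<close>, the uniform
  law and the noise. Integrating out the stopping time then averages the laws at fixed
  times.\<close>

lemma measure_stopped_law: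
  assumes M: "prob_space M"
    and W1: "W1 \<in> M \<rightarrow>\<^sub>M restrict_space borel W" "distr M (restrict_space borel W) W1 = \<mu>1"
    and T: "T \<in> M \<rightarrow>\<^sub>M count_space {1..n}"
      "distr M (count_space {1..n}) T = uniform_count_measure {1..n}"
    and Z: "\<And>t. t \<in> {1..n} \<Longrightarrow> Z t \<in> borel_measurable M"
      "\<And>t. t \<in> {1..n} \<Longrightarrow> distr M borel (Z t) = gaussian 0"
    and indep_Z: "prob_space.indep_vars M (\<lambda>_. borel) Z {1..n}"
    and indep_W1_T: "indep_rvs M (restrict_space borel W) W1 (count_space {1..n}) T"
    and indep_W1_T_Z: "indep_rvs M
          (restrict_space borel W \<Otimes>\<^sub>M count_space {1..n}) (\<lambda>\<omega>. (W1 \<omega>, T \<omega>))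
          (\<Pi>\<^sub>M t\<in>{1..n}. borel) (\<lambda>\<omega>. \<lambda>t\<in>{1..n}. Z t \<omega>)"
    and n: "1 \<le> n" and g: "g \<in> {1..n} \<rightarrow> F" and A: "A \<in> sets (restrict_space borel W)"
  shows "measure (stopped_law M W \<Psi> \<sigma> W1 T Z g) A = 1 / real n * (\<Sum>t=1..n. measure (law g t) A)"
proof -
  interpret M: prob_space M by fact
  interpret mu1: prob_space \<mu>1 by (rule prob_mu1)
  interpret noise: prob_space noise by (rule prob_space_noise)
  define U where "U = uniform_count_measure {1..n}"
  interpret U: prob_space U unfolding U_def using n by (intro prob_space_uniform_count_measure) auto
  have sets_U[measurable_cong]: "sets U = sets (count_space {1..n})"
    and space_U: "space U = {1..n}"
    by (simp_all add: U_def sets_uniform_count_measure space_uniform_count_measure)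
  have noise: "distr M (\<Pi>\<^sub>M t\<in>{1..n}. borel) (\<lambda>\<omega>. \<lambda>t\<in>{1..n}. Z t \<omega>) = noise"
  proof -
    have "distr M (\<Pi>\<^sub>M t\<in>{1..n}. borel) (\<lambda>\<omega>. \<lambda>t\<in>{1..n}. Z t \<omega>) = (\<Pi>\<^sub>M t\<in>{1..n}. distr M borel (Z t))"
      using indep_Z n Z(1) by (subst (asm) M.indep_vars_iff_distr_eq_PiM') auto
    also have "\<dots> = noise" using Z(2) by (intro PiM_cong) auto
    finally show ?thesis .
  qed
  let ?R = "(restrict_space borel W \<Otimes>\<^sub>M count_space {1..n}) \<Otimes>\<^sub>M (\<Pi>\<^sub>M t\<in>{1..n}. (borel :: 'a measure))"
  let ?X = "\<lambda>\<omega>. ((W1 \<omega>, T \<omega>), \<lambda>t\<in>{1..n}. Z t \<omega>)"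
  let ?\<Phi> = "\<lambda>((w, s), z). iterate W \<Psi> \<sigma> g w z s"
  \<comment> \<open>The two independence assumptions are nested: \<open>W1\<close> and
    \<open>T\<close> first, then this pair and the noise.\<close>
  have joint: "distr M ?R ?X = (\<mu>1 \<Otimes>\<^sub>M U) \<Otimes>\<^sub>M noise"
    using indep_rvs_distr[OF M indep_W1_T_Z] indep_rvs_distr[OF M indep_W1_T]
    by (simp only: W1 T noise U_def)
  have X: "?X \<in> M \<rightarrow>\<^sub>M ?R"
    using indep_W1_T_Z by (intro measurable_Pair) (auto simp: indep_rvs_def)
  have \<Phi>: "?\<Phi> \<in> (\<mu>1 \<Otimes>\<^sub>M U) \<Otimes>\<^sub>M noise \<rightarrow>\<^sub>M restrict_space borel W"
  proof -
    have "(\<lambda>p. iterate W \<Psi> \<sigma> g (fst (fst p)) (snd p) t) \<in> (\<mu>1 \<Otimes>\<^sub>M U) \<Otimes>\<^sub>M noise \<rightarrow>\<^sub>M restrict_space borel W"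
      if "t \<in> {1..n}" for t
    proof -
      have "(\<lambda>p. (fst (fst p), snd p)) \<in> (\<mu>1 \<Otimes>\<^sub>M U) \<Otimes>\<^sub>M noise \<rightarrow>\<^sub>M \<mu>1 \<Otimes>\<^sub>M noise" by measurable
      from measurable_compose[OF this iterate_measurable[OF g, of t]] that
      show ?thesis by simp
    qed
    moreover have "(\<lambda>p. snd (fst p)) \<in> (\<mu>1 \<Otimes>\<^sub>M U) \<Otimes>\<^sub>M noise \<rightarrow>\<^sub>M count_space {1..n}"
      by measurable
    \<comment> \<open>The stopping time has countably many values, so measurability at each fixed
      value is enough.\<close>
    ultimately have "(\<lambda>p. iterate W \<Psi> \<sigma> g (fst (fst p)) (snd p) (snd (fst p))) \<in>
        (\<mu>1 \<Otimes>\<^sub>M U) \<Otimes>\<^sub>M noise \<rightarrow>\<^sub>M restrict_space borel W"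
      by (rule measurable_compose_countable') auto
    then show ?thesis by (simp add: case_prod_beta')
  qed
  have R: "sets ?R = sets ((\<mu>1 \<Otimes>\<^sub>M U) \<Otimes>\<^sub>M noise)"
    by (simp only: joint[symmetric] sets_distr)
  have "stopped_law M W \<Psi> \<sigma> W1 T Z g = distr M (restrict_space borel W) (?\<Phi> \<circ> ?X)"
    unfolding stopped_law_def
  proof (rule distr_cong)
    fix \<omega> assume "\<omega> \<in> space M"
    then have "T \<omega> \<in> {1..n}" using measurable_space[OF T(1)] by simp
    \<comment> \<open>Restricting the noise to \<open>{1..n}\<close> changes only coordinates that
      are never read, since \<open>T \<omega> \<le> n\<close>.\<close>
    then show "iterate W \<Psi> \<sigma> g (W1 \<omega>) (\<lambda>t. Z t \<omega>) (T \<omega>) = (?\<Phi> \<circ> ?X) \<omega>"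
      by (auto intro!: iterate_cong)
  qed auto
  also have "\<dots> = distr (distr M ?R ?X) (restrict_space borel W) ?\<Phi>"
    using \<Phi> X R by (intro distr_distr[symmetric]) (simp_all cong: measurable_cong_sets)
  finally have law_eq: "stopped_law M W \<Psi> \<sigma> W1 T Z g = distr ((\<mu>1 \<Otimes>\<^sub>M U) \<Otimes>\<^sub>M noise) (restrict_space borel W) ?\<Phi>"
    by (simp only: joint)
  let ?I = "\<lambda>w s z. indicator A (iterate W \<Psi> \<sigma> g w z s) :: ennreal"
  have ind: "(\<lambda>p. indicator A (?\<Phi> p) :: ennreal) \<in> borel_measurable ((\<mu>1 \<Otimes>\<^sub>M U) \<Otimes>\<^sub>M noise)"
    by (rule measurable_compose[OF \<Phi>]) (use A in simp)
  have inner: "(\<lambda>p. \<integral>\<^sup>+z. ?I (fst p) (snd p) z \<partial>noise) \<in> borel_measurable (\<mu>1 \<Otimes>\<^sub>M U)"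
    using noise.borel_measurable_nn_integral_fst[OF ind] by (simp add: case_prod_beta')
  have "emeasure (stopped_law M W \<Psi> \<sigma> W1 T Z g) A = (\<integral>\<^sup>+v. indicator A v \<partial>stopped_law M W \<Psi> \<sigma> W1 T Z g)"
    by (rule nn_integral_indicator[symmetric]) (simp add: law_eq A)
  also have "\<dots> = (\<integral>\<^sup>+p. indicator A (?\<Phi> p) \<partial>((\<mu>1 \<Otimes>\<^sub>M U) \<Otimes>\<^sub>M noise))"
    unfolding law_eq by (rule nn_integral_distr[OF \<Phi>]) (use A in simp)
  also have "\<dots> = (\<integral>\<^sup>+p. \<integral>\<^sup>+z. ?I (fst p) (snd p) z \<partial>noise \<partial>(\<mu>1 \<Otimes>\<^sub>M U))"
    using noise.nn_integral_fst[OF ind] by (simp add: case_prod_beta')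
  also have "\<dots> = (\<integral>\<^sup>+w. \<integral>\<^sup>+s. \<integral>\<^sup>+z. ?I w s z \<partial>noise \<partial>U \<partial>\<mu>1)"
    using U.nn_integral_fst[OF inner] by simp
  also have "\<dots> = (\<integral>\<^sup>+w. (\<Sum>s=1..n. ennreal (1 / real n) * (\<integral>\<^sup>+z. ?I w s z \<partial>noise)) \<partial>\<mu>1)"
    unfolding U_def uniform_count_measure_def
    by (subst nn_integral_point_measure_finite) (auto simp: ennreal_of_nat_eq_real_of_nat)
  also have "\<dots> = (\<Sum>s=1..n. ennreal (1 / real n) * (\<integral>\<^sup>+w. \<integral>\<^sup>+z. ?I w s z \<partial>noise \<partial>\<mu>1))"
  proof -
    have "(\<lambda>w. \<integral>\<^sup>+z. ?I w s z \<partial>noise) \<in> borel_measurable \<mu>1" if "s \<in> {1..n}" for s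
      using measurable_compose[OF measurable_Pair2' inner, of s] that by (simp add: space_U)
    then show ?thesis by (subst nn_integral_sum) (auto simp: nn_integral_cmult)
  qed
  also have "\<dots> = (\<Sum>s=1..n. ennreal (1 / real n) * emeasure (law g s) A)"
  proof (intro sum.cong refl arg_cong2[where f="(*)"])
    fix s assume "s \<in> {1..n}"
    then show "(\<integral>\<^sup>+w. \<integral>\<^sup>+z. ?I w s z \<partial>noise \<partial>\<mu>1) = emeasure (law g s) A"
      using nn_integral_law[OF g, of s "indicator A"] A by simp
  qed
  also have "\<dots> = (\<Sum>s=1..n. ennreal (1 / real n * measure (law g s) A))"
  proof (intro sum.cong refl)
    fix s assume "s \<in> {1..n}"
    then interpret L: prob_space "law g s" using g by (intro prob_space_law) auto
    show "ennreal (1 / real n) * emeasure (law g s) A = ennreal (1 / real n * measure (law g s) A)"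
      by (subst ennreal_mult) (auto simp: L.emeasure_eq_measure)
  qed
  also have "\<dots> = ennreal (1 / real n * (\<Sum>s=1..n. measure (law g s) A))"
    by (simp add: sum_ennreal sum_distrib_left)
  finally show ?thesis
    by (simp add: measure_def sum_nonneg)
qed

end

section \<open>Differential privacy of the stopped iteration\<close>

text \<open>A real supremum dominates its members only if it is bounded above. The triangle
  inequality gives the bound \<open>2 * B\<close> at each of the three nested levels.\<close>

lemma le_sensitivity:
  assumes B: "\<forall>g\<in>F. \<forall>w\<in>W. norm (\<Psi> g w) \<le> B" and gh: "g \<in> F" "h \<in> F" and w: "w \<in> W"
  shows "norm (\<Psi> g w - \<Psi> h w) \<le> sensitivity W F \<Psi>"
proof -
  let ?d = "\<lambda>f g w. norm (\<Psi> f w - \<Psi> g w)"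
  have b: "?d f g w \<le> 2 * B" if "f \<in> F" "g \<in> F" "w \<in> W" for f g w
  proof -
    have "norm (\<Psi> f w) \<le> B" "norm (\<Psi> g w) \<le> B" using B that by auto
    then show ?thesis using norm_triangle_ineq4[of "\<Psi> f w" "\<Psi> g w"] by linarith
  qed
  have W: "W \<noteq> {}" and F: "F \<noteq> {}" using w gh by auto
  have b1: "(SUP w\<in>W. ?d f g w) \<le> 2 * B" if "f \<in> F" "g \<in> F" for f g
    using that by (intro cSUP_least[OF W] b)
  have b2: "(SUP g\<in>F. SUP w\<in>W. ?d f g w) \<le> 2 * B" if "f \<in> F" for f
    using that by (intro cSUP_least[OF F] b1)
  have "?d g h w \<le> (SUP w\<in>W. ?d g h w)"
    using b[OF gh] by (intro cSUP_upper[OF w] bdd_aboveI2)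
  also have "\<dots> \<le> (SUP h\<in>F. SUP w\<in>W. ?d g h w)"
    using b1[OF gh(1)] by (intro cSUP_upper[OF gh(2)] bdd_aboveI2)
  also have "\<dots> \<le> sensitivity W F \<Psi>"
    unfolding sensitivity_def using b2 by (intro cSUP_upper[OF gh(1)] bdd_aboveI2)
  finally show ?thesis .
qed

text \<open>The term under the maximum in \<open>stopped_delta\<close>, with \<open>\<gamma>\<close>
  for \<open>exp \<epsilon>\<close>, isolated because it bounds the divergence for one differing
  index.\<close>

definition delta_at ::
  "'a::euclidean_space \<Rightarrow> nat \<Rightarrow> 'a set \<Rightarrow> 'c set \<Rightarrow> ('c \<Rightarrow> 'a \<Rightarrow> 'a) \<Rightarrow> (nat \<Rightarrow> real) \<Rightarrow> real \<Rightarrow> (nat \<Rightarrow> 'c) \<Rightarrow> nat \<Rightarrow> real"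
where
  "delta_at u n W F \<Psi> \<sigma> \<gamma> f i =
     1 / real n * (\<Sum>t=i..n. theta u \<gamma> (sensitivity W F \<Psi> / \<sigma> i) *
        (\<Prod>j=i+1..t. theta u \<gamma> (diameter (\<Psi> (f j) ` W) / \<sigma> j)))"

lemma stopped_delta_eq: "stopped_delta u n W F \<Psi> \<sigma> \<epsilon> f = (MAX i\<in>{1..n}. delta_at u n W F \<Psi> \<sigma> (exp \<epsilon>) f i)"
  by (simp add: stopped_delta_def delta_at_def)

text \<open>The product starts at \<open>i + 1\<close>, so the cost at \<open>i\<close> never enters
  and neighbours at \<open>i\<close> share the same bound.\<close>

lemma delta_at_cong:
  assumes "\<And>j. j \<in> {1..n} - {i} \<Longrightarrow> f j = g j"
  shows "delta_at u n W F \<Psi> \<sigma> \<gamma> f i = delta_at u n W F \<Psi> \<sigma> \<gamma> g i"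
  unfolding delta_at_def
proof (intro arg_cong2[where f="(*)"] sum.cong prod.cong refl)
  fix t j assume "t \<in> {i..n}" "j \<in> {i+1..t}"
  then show "theta u \<gamma> (diameter (\<Psi> (f j) ` W) / \<sigma> j) = theta u \<gamma> (diameter (\<Psi> (g j) ` W) / \<sigma> j)"
    using assms[of j] by simp
qed

lemma sum_power_diff_le:
  fixes q :: real
  assumes "0 \<le> q" "q < 1" "i \<le> n"
  shows "(\<Sum>t=i..n. q ^ (t - i)) \<le> inverse (1 - q)"
proof -
  have "(\<Sum>t=i..n. q ^ (t - i)) = (\<Sum>k<Suc (n - i). q ^ k)"
    using assms(3) by (simp add: sum.atLeastAtMost_shift_0 atLeast0AtMost lessThan_Suc_atMost)
  also have "\<dots> = (1 - q ^ Suc (n - i)) / (1 - q)"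
    using assms by (subst geometric_sum) (auto simp: field_simps)
  also have "\<dots> \<le> 1 / (1 - q)"
    using assms by (intro divide_right_mono) auto
  finally show ?thesis by (simp add: inverse_eq_divide)
qed

text \<open>Monotonicity of \<open>theta\<close> bounds every factor by its value at the largest
  ratio. The product up to \<open>t\<close> has \<open>t - i\<close> factors, which leaves a partial
  geometric sum.\<close>

lemma delta_at_le_geometric:
  fixes u :: "'a::euclidean_space"
  assumes u: "norm u = 1" and \<gamma>: "1 \<le> \<gamma>" and i: "i \<in> {1..n}"
    and s: "0 < s" "\<And>t. t \<in> {1..n} \<Longrightarrow> s \<le> \<sigma> t"
    and d: "\<And>t. t \<in> {1..n} \<Longrightarrow> 0 \<le> diameter (\<Psi> (f t) ` W)" "\<And>t. t \<in> {1..n} \<Longrightarrow> diameter (\<Psi> (f t) ` W) \<le> D"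
    and sens: "0 \<le> sensitivity W F \<Psi>"
  shows "delta_at u n W F \<Psi> \<sigma> \<gamma> f i \<le>
    1 / real n * theta u \<gamma> (sensitivity W F \<Psi> / s) * inverse (1 - theta u \<gamma> (D / s))"
proof -
  let ?p = "theta u \<gamma> (sensitivity W F \<Psi> / s)" and ?q = "theta u \<gamma> (D / s)"
  let ?\<theta> = "\<lambda>j. theta u \<gamma> (diameter (\<Psi> (f j) ` W) / \<sigma> j)"
  have mono: "theta u \<gamma> (a / \<sigma> j) \<le> theta u \<gamma> (b / s)" if "j \<in> {1..n}" "0 \<le> a" "a \<le> b" for a b j
    using that s(1) s(2)[of j] by (intro theta_mono u \<gamma> frac_le) auto
  have "(\<Sum>t=i..n. theta u \<gamma> (sensitivity W F \<Psi> / \<sigma> i) * (\<Prod>j=i+1..t. ?\<theta> j)) \<le> (\<Sum>t=i..n. ?p * ?q ^ (t - i))"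
  proof (intro sum_mono mult_mono)
    fix t assume t: "t \<in> {i..n}"
    have "(\<Prod>j=i+1..t. ?\<theta> j) \<le> (\<Prod>j=i+1..t. ?q)"
    proof (intro prod_mono conjI)
      fix j assume "j \<in> {i+1..t}"
      then have "j \<in> {1..n}" using t i by auto
      then show "?\<theta> j \<le> ?q" by (intro mono d)
    qed (rule theta_nonneg[OF \<gamma>])
    then show "(\<Prod>j=i+1..t. ?\<theta> j) \<le> ?q ^ (t - i)" by simp
  qed (use mono[OF i sens] theta_nonneg[OF \<gamma>] in \<open>auto intro!: prod_nonneg\<close>)
  also have "\<dots> = ?p * (\<Sum>t=i..n. ?q ^ (t - i))" by (simp add: sum_distrib_left)
  also have "\<dots> \<le> ?p * inverse (1 - ?q)"
    using i theta_nonneg[OF \<gamma>] theta_less_1[OF u \<gamma>] by (intro mult_left_mono sum_power_diff_le) auto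
  finally show ?thesis
    unfolding delta_at_def by (simp add: divide_right_mono)
qed

text \<open>At most \<open>n\<close> summands, each at most 1, are averaged. The bound is uniform in
  the collection and so makes the supremum of \<open>stopped_delta\<close> over all collections well
  behaved.\<close>

lemma delta_at_le_1:
  fixes u :: "'a::euclidean_space"
  assumes u: "norm u = 1" and \<gamma>: "1 \<le> \<gamma>" and i: "i \<in> {1..n}"
  shows "delta_at u n W F \<Psi> \<sigma> \<gamma> f i \<le> 1"
proof -
  have \<theta>: "0 \<le> theta u \<gamma> r" "theta u \<gamma> r \<le> 1" for r
    using theta_nonneg[OF \<gamma>] theta_less_1[OF u \<gamma>, of r] by auto
  have "(\<Sum>t=i..n. theta u \<gamma> (sensitivity W F \<Psi> / \<sigma> i) * (\<Prod>j=i+1..t. theta u \<gamma> (diameter (\<Psi> (f j) ` W) / \<sigma> j)))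
      \<le> (\<Sum>t=i..n. 1)"
    using \<theta> by (intro sum_mono mult_le_one prod_le_1 prod_nonneg) auto
  also have "\<dots> \<le> real n" using i by auto
  finally show ?thesis
    using i unfolding delta_at_def by (simp add: field_simps)
qed

text \<open>Since \<open>\<delta>\<close> depends on the collection through the diameters, privacy
  is stated twice: for pairs containing the given \<open>f\<close> with its own
  \<open>\<delta>\<close>, and for all pairs with the supremum of \<open>\<delta>\<close>.
  Extensionality makes two costs, or two collections, differ only if they differ on
  \<open>W\<close>, or on \<open>{1..n}\<close>.\<close>

theorem theorem6:
  fixes W :: "'a::euclidean_space set"
    and F :: "('a \<Rightarrow> real) set"
    and \<Psi> :: "('a \<Rightarrow> real) \<Rightarrow> 'a \<Rightarrow> 'a"
    and n :: nat
    and \<sigma> :: "nat \<Rightarrow> real"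
    and \<mu>1 :: "'a measure"
    and M :: "'w measure"
    and W1 :: "'w \<Rightarrow> 'a"
    and T :: "'w \<Rightarrow> nat"
    and Z :: "nat \<Rightarrow> 'w \<Rightarrow> 'a"
    and f :: "nat \<Rightarrow> 'a \<Rightarrow> real"
    and u :: 'a
    and \<epsilon> :: real
  assumes "closed W" and "convex W"
    and F_convex: "\<forall>g\<in>F. g \<in> extensional W \<and> convex_on W g"
    and Psi_measurable: "\<forall>g\<in>F. \<Psi> g \<in> borel_measurable (restrict_space borel W)"
    and Psi_bounded: "\<exists>B. \<forall>g\<in>F. \<forall>w\<in>W. norm (\<Psi> g w) \<le> B"
    and "n \<ge> 1" and "\<forall>t\<in>{1..n}. \<sigma> t > 0"
    and "prob_space M"
    and mu1: "prob_space \<mu>1" "sets \<mu>1 = sets (restrict_space borel W)"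
    and W1: "W1 \<in> measurable M (restrict_space borel W)"
            "distr M (restrict_space borel W) W1 = \<mu>1"
    and T: "T \<in> measurable M (count_space {1..n})"
           "distr M (count_space {1..n}) T = uniform_count_measure {1..n}"
    and Z: "\<forall>t\<in>{1..n}. Z t \<in> borel_measurable M \<and> distr M borel (Z t) = gaussian 0"
    and indep_Z: "prob_space.indep_vars M (\<lambda>_. borel) Z {1..n}"
    and indep_W1_T: "indep_rvs M (restrict_space borel W) W1 (count_space {1..n}) T"
    and indep_W1_T_Z: "indep_rvs M
          (restrict_space borel W \<Otimes>\<^sub>M count_space {1..n}) (\<lambda>\<omega>. (W1 \<omega>, T \<omega>))
          (\<Pi>\<^sub>M t\<in>{1..n}. borel) (\<lambda>\<omega>. \<lambda>t\<in>{1..n}. Z t \<omega>)"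
    and f: "f \<in> {1..n} \<rightarrow>\<^sub>E F"
    and "norm u = 1"
    and "\<epsilon> \<ge> 0"
  shows
    "dp n {(g, h) \<in> ({1..n} \<rightarrow>\<^sub>E F) \<times> ({1..n} \<rightarrow>\<^sub>E F). g = f \<or> h = f}
        (stopped_law M W \<Psi> \<sigma> W1 T Z) \<epsilon> (stopped_delta u n W F \<Psi> \<sigma> \<epsilon> f) \<and>
     dp n (({1..n} \<rightarrow>\<^sub>E F) \<times> ({1..n} \<rightarrow>\<^sub>E F))
        (stopped_law M W \<Psi> \<sigma> W1 T Z) \<epsilon> (SUP g\<in>{1..n} \<rightarrow>\<^sub>E F. stopped_delta u n W F \<Psi> \<sigma> \<epsilon> g) \<and>
     stopped_delta u n W F \<Psi> \<sigma> \<epsilon> f \<le>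
       1 / real n * theta u (exp \<epsilon>) (sensitivity W F \<Psi> / (MIN t\<in>{1..n}. \<sigma> t)) *
       inverse (1 - theta u (exp \<epsilon>)
         ((MAX t\<in>{1..n}. diameter (\<Psi> (f t) ` W)) / (MIN t\<in>{1..n}. \<sigma> t)))"
proof -
  obtain B where B: "\<forall>g\<in>F. \<forall>w\<in>W. norm (\<Psi> g w) \<le> B" using Psi_bounded by auto
  interpret noisy_iteration W F \<Psi> \<sigma> n \<mu>1
  proof (rule noisy_iteration.intro)
    show "\<Psi> g \<in> borel_measurable (restrict_space borel W)" if "g \<in> F" for g
      using Psi_measurable that by blast
    show "0 < \<sigma> t" if "t \<in> {1..n}" for t
      using \<open>\<forall>t\<in>{1..n}. \<sigma> t > 0\<close> that by blast
  qed fact+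
  define \<gamma> where "\<gamma> = exp \<epsilon>"
  have \<gamma>: "1 \<le> \<gamma>" using \<open>\<epsilon> \<ge> 0\<close> by (simp add: \<gamma>_def)
  note u = \<open>norm u = 1\<close>
  let ?S = "stopped_law M W \<Psi> \<sigma> W1 T Z"
  let ?\<delta> = "\<lambda>f. stopped_delta u n W F \<Psi> \<sigma> \<epsilon> f"
  let ?\<Delta> = "delta_at u n W F \<Psi> \<sigma> \<gamma>"
  \<comment> \<open>For a bounded image, \<open>diameter\<close> really bounds all
    distances.\<close>
  have bounded_image: "bounded (\<Psi> g ` W)" if "g \<in> F" for g
    using B that by (auto simp: bounded_iff)
  have stopped: "measure (?S g) A = 1 / real n * (\<Sum>t=1..n. measure (law g t) A)"
    if "g \<in> {1..n} \<rightarrow> F" "A \<in> sets (restrict_space borel W)" for g A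
    using Z by (intro measure_stopped_law that \<open>prob_space M\<close> W1 T indep_Z indep_W1_T indep_W1_T_Z \<open>n \<ge> 1\<close>) auto
  have neighbor_le: "hockey_stick \<gamma> (?S g) (?S h) \<le> ?\<Delta> g i"
    if g: "g \<in> {1..n} \<rightarrow>\<^sub>E F" and h: "h \<in> {1..n} \<rightarrow>\<^sub>E F" and i: "i \<in> {1..n}" and "neighboring n i g h" for g h i
  proof (rule hockey_stick_least)
    have eq: "g t = h t" if "t \<in> {1..n} - {i}" for t
      using \<open>neighboring n i g h\<close> that by (auto simp: neighboring_def)
    have gF: "g \<in> {1..n} \<rightarrow> F" and hF: "h \<in> {1..n} \<rightarrow> F" using g h by (auto simp: PiE_iff)
    let ?b = "\<lambda>t. theta u \<gamma> (sensitivity W F \<Psi> / \<sigma> i) * (\<Prod>j=i+1..t. theta u \<gamma> (diameter (\<Psi> (g j) ` W) / \<sigma> j))"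
    fix A assume "A \<in> sets (?S g)"
    then have A: "A \<in> sets (restrict_space borel W)" by (simp add: stopped_law_def)
    have step: "measure (law g t) A - \<gamma> * measure (law h t) A \<le> (if i \<le> t then ?b t else 0)" if t: "t \<in> {1..n}" for t
    proof -
      have "measure (law g t) A - \<gamma> * measure (law h t) A \<le> hockey_stick \<gamma> (law g t) (law h t)"
        using t \<gamma> A by (intro hockey_stick_upper prob_space_law gF) auto
      also have "\<dots> \<le> (if i \<le> t then ?b t else 0)"
      proof (cases "i \<le> t")
        case True
        have "hockey_stick \<gamma> (law g t) (law h t) \<le> ?b t"
          using gF hF i t True
          by (intro hockey_stick_law_le[OF gF hF i eq u \<gamma>] le_sensitivity[OF B] bounded_image) auto
        then show ?thesis using True by simp
      next
        case False
        \<comment> \<open>Stopping before step \<open>i\<close> reveals nothing about the differing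
          cost, so these times contribute nothing and the sum starts at \<open>i\<close>.\<close>
        then have "law g t = law h t" using t by (intro law_cong eq) auto
        then show ?thesis using False hockey_stick_self_le[OF \<gamma>] by simp
      qed
      finally show ?thesis .
    qed
    have "measure (?S g) A - \<gamma> * measure (?S h) A =
        1 / real n * (\<Sum>t=1..n. measure (law g t) A - \<gamma> * measure (law h t) A)"
      by (simp only: stopped[OF gF A] stopped[OF hF A] sum_subtractf sum_distrib_left[symmetric])
        (simp add: algebra_simps)
    also have "\<dots> \<le> 1 / real n * (\<Sum>t=1..n. if i \<le> t then ?b t else 0)"
      by (intro mult_left_mono sum_mono step) auto
    also have "(\<Sum>t=1..n. if i \<le> t then ?b t else 0) = (\<Sum>t\<in>{t\<in>{1..n}. i \<le> t}. ?b t)"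
      by (rule sum.inter_filter[symmetric]) simp
    also have "{t\<in>{1..n}. i \<le> t} = {i..n}" using i by auto
    finally show "measure (?S g) A - \<gamma> * measure (?S h) A \<le> ?\<Delta> g i"
      by (simp only: delta_at_def)
  qed
  have \<Delta>_le: "?\<Delta> g i \<le> ?\<delta> g" if "i \<in> {1..n}" for g i
    using that unfolding stopped_delta_eq \<gamma>_def by (intro Max_ge) auto
  \<comment> \<open>Both versions are recorded because the fixed collection \<open>f\<close> may be
    either member of a neighbouring pair.\<close>
  have neighbor_le_\<delta>: "hockey_stick (exp \<epsilon>) (?S g) (?S h) \<le> ?\<delta> g" "hockey_stick (exp \<epsilon>) (?S g) (?S h) \<le> ?\<delta> h"
    if gh: "g \<in> {1..n} \<rightarrow>\<^sub>E F" "h \<in> {1..n} \<rightarrow>\<^sub>E F" and i: "i \<in> {1..n}" and nb: "neighboring n i g h" for g h i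
  proof -
    have "?\<Delta> g i = ?\<Delta> h i" using nb by (intro delta_at_cong) (auto simp: neighboring_def)
    then show "hockey_stick (exp \<epsilon>) (?S g) (?S h) \<le> ?\<delta> g" "hockey_stick (exp \<epsilon>) (?S g) (?S h) \<le> ?\<delta> h"
      using neighbor_le[OF gh i nb] \<Delta>_le[OF i, of g] \<Delta>_le[OF i, of h] by (simp_all add: \<gamma>_def)
  qed
  have dp_f: "dp n {(g, h) \<in> ({1..n} \<rightarrow>\<^sub>E F) \<times> ({1..n} \<rightarrow>\<^sub>E F). g = f \<or> h = f} ?S \<epsilon> (?\<delta> f)"
    unfolding dp_def dp_at_index_def using neighbor_le_\<delta> by (auto intro!: SUP_least simp del: One_nat_def)
  have \<delta>_le_1: "?\<delta> g \<le> 1" for g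
    unfolding stopped_delta_eq using \<open>n \<ge> 1\<close> \<gamma> by (intro Max.boundedI) (auto intro!: delta_at_le_1 u simp: \<gamma>_def)
  \<comment> \<open>Boundedness lets each collection's own \<open>\<delta>\<close> be compared with
    the supremum.\<close>
  have "bdd_above (?\<delta> ` ({1..n} \<rightarrow>\<^sub>E F))" by (rule bdd_aboveI2[OF \<delta>_le_1])
  then have \<delta>_le_SUP: "?\<delta> g \<le> (SUP g\<in>{1..n} \<rightarrow>\<^sub>E F. ?\<delta> g)" if "g \<in> {1..n} \<rightarrow>\<^sub>E F" for g
    using that by (rule cSUP_upper[rotated])
  have dp_all: "dp n (({1..n} \<rightarrow>\<^sub>E F) \<times> ({1..n} \<rightarrow>\<^sub>E F)) ?S \<epsilon> (SUP g\<in>{1..n} \<rightarrow>\<^sub>E F. ?\<delta> g)"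
    unfolding dp_def dp_at_index_def
    using order_trans[OF neighbor_le_\<delta>(1) \<delta>_le_SUP] by (auto intro!: SUP_least simp del: One_nat_def)
  have fF: "f t \<in> F" if "t \<in> {1..n}" for t using f that by (auto simp: PiE_iff)
  have sens: "0 \<le> sensitivity W F \<Psi>"
  proof -
    obtain w where "w \<in> W" using W_nonempty by auto
    then show ?thesis
      using le_sensitivity[OF B, of "f 1" "f 1" w] fF[of 1] \<open>n \<ge> 1\<close> by simp
  qed
  have "?\<Delta> f i \<le> 1 / real n * theta u \<gamma> (sensitivity W F \<Psi> / (MIN t\<in>{1..n}. \<sigma> t)) *
      inverse (1 - theta u \<gamma> ((MAX t\<in>{1..n}. diameter (\<Psi> (f t) ` W)) / (MIN t\<in>{1..n}. \<sigma> t)))"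
    if "i \<in> {1..n}" for i
  proof (rule delta_at_le_geometric[OF u \<gamma> that])
    show "0 < (MIN t\<in>{1..n}. \<sigma> t)" using \<open>n \<ge> 1\<close> sigma_pos by (subst Min_gr_iff) auto
    show "0 \<le> diameter (\<Psi> (f t) ` W)" if "t \<in> {1..n}" for t
      by (rule diameter_ge_0[OF bounded_image[OF fF[OF that]]])
  qed (auto intro!: Min_le Max_ge simp: sens)
  then have "?\<delta> f \<le> 1 / real n * theta u (exp \<epsilon>) (sensitivity W F \<Psi> / (MIN t\<in>{1..n}. \<sigma> t)) *
      inverse (1 - theta u (exp \<epsilon>) ((MAX t\<in>{1..n}. diameter (\<Psi> (f t) ` W)) / (MIN t\<in>{1..n}. \<sigma> t)))"
    unfolding stopped_delta_eq \<gamma>_def using \<open>n \<ge> 1\<close> by (intro Max.boundedI) auto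
  with dp_f dp_all show ?thesis by blast
qed

end
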